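(* Let $(\mathfrak{g}(a,v,A),J,g)$ be a Hermitian almost abelian Lie algebra of real dimension $2n$, with fixed adapted unitary basis $\{e_1,\ldots,e_{2n}\}$ and algebraic data $(a,v,A)$. Then $(J,g)$ is balanced if and only if $v=0$ and $\operatorname{tr}A=0$. If $(J,g)$ is balanced, its Bismut-Ricci form $\rho^B$ and Chern-Ricci form $\rho^C$ are given by $$\rho^B=\rho^C=-a^2\,e^1\wedge e^{2n}.$$ In particular, a unimodular almost abelian Lie algebra admitting a balanced Hermitian structure is decomposable (i.e. isomorphic to a direct sum of two non-zero Lie algebras), and the Bismut-Ricci form of any balanced Hermitian structure on it vanishes.
   Context: A (real, finite-dimensional) Lie algebra $\mathfrak{g}$ is almost abelian if it contains an abelian ideal $\mathfrak{n}$ of codimension one. A Hermitian structure $(J,g)$ on $\mathfrak{g}$ is an integrable complex structure $J$ together with an inner product $g$ satisfying $g(J\cdot,J\cdot)=g$; its fundamental form is $\omega=g(J\cdot,\cdot)$. Elements of $\Lambda^k\mathfrak{g}^*$ are regarded as left-invariant forms, and $d$ is the Chevalley-Eilenberg differential ($d\alpha(X,Y)=-\alpha([X,Y])$ for 1-forms). With $\dim_{\mathbb{R}}\mathfrak{g}=2n$, $(J,g)$ is balanced if $d\omega^{n-1}=0$ (equivalently $d^*\omega=0$). $\mathfrak g$ is unimodular if $\operatorname{tr}\operatorname{ad}_X=0$ for all $X\in\mathfrak{g}$. Given a Hermitian almost abelian Lie algebra $(\mathfrak{g},J,g)$ of dimension $2n$, fix an abelian ideal $\mathfrak{n}$ of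 codimension one and set $\mathfrak{n}_1=\mathfrak{n}\cap J\mathfrak{n}$, $J_1=J|_{\mathfrak{n}_1}$, $\mathfrak{k}=\mathfrak{n}^{\perp_g}$. An adapted unitary basis is a $g$-orthonormal basis $\{e_1,\ldots,e_{2n}\}$ with $\mathfrak{n}=\mathrm{span}\langle e_1,\ldots,e_{2n-1}\rangle$, $\mathfrak{n}_1=\mathrm{span}\langle e_2,\ldots,e_{2n-1}\rangle$, $Je_i=e_{2n+1-i}$ for $i=1,\ldots,n$ (so $\mathfrak{k}=\mathbb{R}e_{2n}$). In such a basis the matrix of $\operatorname{ad}_{e_{2n}}|_{\mathfrak{n}}$ has the form $\begin{pmatrix} a&0\\ v&A\end{pmatrix}$ with $a\in\mathbb{R}$, $v\in\mathfrak{n}_1$ and $A\in\mathfrak{gl}(\mathfrak{n}_1)$ commuting with $J_1$. The notation $(\mathfrak{g}(a,v,A),J,g)$ means that such a basis, with these algebraic data, has been fixed; $\{e^i\}$ is the dual basis. For $\tau\in\mathbb{R}$ the canonical Hermitian connection $\nabla^\tau$ is defined by $g(\nabla^\tau_XY,Z)=g(\nabla^g_XY,Z)+\frac{1-\tau}{4}T(X,Y,Z)+\frac{1+\tau}{4}C(X,Y,Z)$, where $\nabla^g$ is the Levi-Civita connection, $T(X,Y,Z)=d\omega(JX,JY,JZ)$ and $C(X,Y,Z)=-d\omega(JX,Y,Z)$. The Bismut connection $\nabla^B$ is $\nabla^{-1}$ and the Chern connection $\nabla^C$ is $\nabla^{1}$. The associated Ricci form is $\rho^\tau(X,Y)=-\frac12\sum_{i=1}^{2n}g(R^\tau(X,Y)e_i,Je_i)$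 with $R^\tau(X,Y)=[\nabla^\tau_X,\nabla^\tau_Y]-\nabla^\tau_{[X,Y]}$; $\rho^B=\rho^{-1}$ and $\rho^C=\rho^{1}$. *)

theory Defs
  imports "HOL-Analysis.Analysis" "HOL-Combinatorics.Permutations"
begin

text \<open>Carriers are explicit only so that a direct sum of two Lie algebras can be spoken of;
  the Lie algebra under study always has carrier \<^term>\<open>UNIV\<close>.\<close>

definition lie_algebra_on ::
    "'a::real_vector set \<Rightarrow> ('a \<Rightarrow> 'a \<Rightarrow> 'a) \<Rightarrow> bool" where
  "lie_algebra_on V br \<longleftrightarrow>
     (\<exists>B. finite B \<and> span B = V) \<and>
     (\<forall>x\<in>V. \<forall>y\<in>V. br x y \<in> V) \<and>
     (\<forall>x\<in>V. \<forall>y\<in>V. \<forall>z\<in>V. \<forall>c d.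
        br (c *\<^sub>R x + d *\<^sub>R y) z = c *\<^sub>R br x z + d *\<^sub>R br y z \<and>
        br z (c *\<^sub>R x + d *\<^sub>R y) = c *\<^sub>R br z x + d *\<^sub>R br z y) \<and>
     (\<forall>x\<in>V. br x x = 0) \<and>
     (\<forall>x\<in>V. \<forall>y\<in>V. \<forall>z\<in>V. br x (br y z) + br y (br z x) + br z (br x y) = 0)"

abbreviation lie_algebra :: "('a::real_vector \<Rightarrow> 'a \<Rightarrow> 'a) \<Rightarrow> bool" where
  "lie_algebra br \<equiv> lie_algebra_on UNIV br"

text \<open>Isomorphic to an external direct sum of two nonzero Lie algebras. Since the summands
  have dimension at most that of the whole, it is no restriction that their carriers are
  subspaces of the same type; their brackets are unrelated to \<^term>\<open>br\<close>.\<close>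

definition decomposable :: "('a::real_vector \<Rightarrow> 'a \<Rightarrow> 'a) \<Rightarrow> bool" where
  "decomposable br \<longleftrightarrow>
     (\<exists>(V1::'a set) (V2::'a set) br1 br2 (f :: 'a \<Rightarrow> 'a \<times> 'a).
        lie_algebra_on V1 br1 \<and> V1 \<noteq> {0} \<and>
        lie_algebra_on V2 br2 \<and> V2 \<noteq> {0} \<and>
        linear f \<and> bij_betw f UNIV (V1 \<times> V2) \<and>
        (\<forall>x y. f (br x y) = (br1 (fst (f x)) (fst (f y)), br2 (snd (f x)) (snd (f y)))))"

definition abelian_ideal ::
    "('a::real_vector \<Rightarrow> 'a \<Rightarrow> 'a) \<Rightarrow> 'a set \<Rightarrow> bool" where
  "abelian_ideal br N \<longleftrightarrow>
     subspace N \<and> (\<forall>x. \<forall>y\<in>N. br x y \<in> N) \<and> (\<forall>x\<in>N. \<forall>y\<in>N. br x y = 0)"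

definition codim_one_abelian_ideal ::
    "('a::real_vector \<Rightarrow> 'a \<Rightarrow> 'a) \<Rightarrow> 'a set \<Rightarrow> bool" where
  "codim_one_abelian_ideal br N \<longleftrightarrow>
     abelian_ideal br N \<and> dim (UNIV :: 'a set) = dim N + 1"

definition almost_abelian :: "('a::real_vector \<Rightarrow> 'a \<Rightarrow> 'a) \<Rightarrow> bool" where
  "almost_abelian br \<longleftrightarrow> (\<exists>N. codim_one_abelian_ideal br N)"

text \<open>Trace of an endomorphism of a finite-dimensional subspace, computed in an arbitrary basis.\<close>

definition trace_on :: "'a::real_vector set \<Rightarrow> ('a \<Rightarrow> 'a) \<Rightarrow> real" where
  "trace_on V f =
     (let B = (SOME B. independent B \<and> span B = V)
      in \<Sum>b\<in>B. representation B (f b) b)"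

definition unimodular :: "('a::real_vector \<Rightarrow> 'a \<Rightarrow> 'a) \<Rightarrow> bool" where
  "unimodular br \<longleftrightarrow> (\<forall>x. trace_on UNIV (br x) = 0)"

definition complex_structure ::
    "('a::real_vector \<Rightarrow> 'a \<Rightarrow> 'a) \<Rightarrow> ('a \<Rightarrow> 'a) \<Rightarrow> bool" where
  "complex_structure br J \<longleftrightarrow>
     linear J \<and> (\<forall>x. J (J x) = - x) \<and>
     (\<forall>x y. br (J x) (J y) - J (br (J x) y) - J (br x (J y)) - br x y = 0)"

definition inner_product :: "('a::real_vector \<Rightarrow> 'a \<Rightarrow> real) \<Rightarrow> bool" where
  "inner_product g \<longleftrightarrow>
     bilinear g \<and> (\<forall>x y. g x y = g y x) \<and> (\<forall>x. x \<noteq> 0 \<longrightarrow> g x x > 0)"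

definition hermitian_structure ::
    "('a::real_vector \<Rightarrow> 'a \<Rightarrow> 'a) \<Rightarrow> ('a \<Rightarrow> 'a) \<Rightarrow> ('a \<Rightarrow> 'a \<Rightarrow> real) \<Rightarrow> bool" where
  "hermitian_structure br J g \<longleftrightarrow>
     complex_structure br J \<and> inner_product g \<and> (\<forall>x y. g (J x) (J y) = g x y)"

text \<open>A \<open>k\<close>-form is a function on lists of vectors, of which only the values on lists of
  length \<open>k\<close> are relevant.\<close>

type_synonym 'a form = "'a list \<Rightarrow> real"

definition one_form :: "('a \<Rightarrow> real) \<Rightarrow> 'a form" where
  "one_form \<alpha> = (\<lambda>X. \<alpha> (X ! 0))"

definition two_form :: "('a \<Rightarrow> 'a \<Rightarrow> real) \<Rightarrow> 'a form" where
  "two_form \<beta> = (\<lambda>X. \<beta> (X ! 0) (X ! 1))"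

definition wedge :: "nat \<Rightarrow> nat \<Rightarrow> 'a form \<Rightarrow> 'a form \<Rightarrow> 'a form" where
  "wedge p q \<alpha> \<beta> = (\<lambda>X.
     (\<Sum>\<sigma> | \<sigma> permutes {..<p + q}.
        of_int (sign \<sigma>) * \<alpha> (map (\<lambda>i. X ! \<sigma> i) [0..<p])
                        * \<beta> (map (\<lambda>i. X ! \<sigma> i) [p..<p + q])) / (fact p * fact q))"

primrec two_form_power :: "'a form \<Rightarrow> nat \<Rightarrow> 'a form" where
  "two_form_power \<beta> 0 = (\<lambda>X. 1)"
| "two_form_power \<beta> (Suc k) = wedge 2 (2 * k) \<beta> (two_form_power \<beta> k)"

definition ce_diff :: "('a \<Rightarrow> 'a \<Rightarrow> 'a) \<Rightarrow> 'a form \<Rightarrow> 'a form" where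
  "ce_diff br \<alpha> = (\<lambda>X.
     \<Sum>j<length X. \<Sum>i<j.
       (-1) ^ (i + j) * \<alpha> (br (X ! i) (X ! j) # nths X (- {i, j})))"

definition fundamental_form ::
    "('a \<Rightarrow> 'a) \<Rightarrow> ('a \<Rightarrow> 'a \<Rightarrow> real) \<Rightarrow> 'a form" where
  "fundamental_form J g = two_form (\<lambda>x y. g (J x) y)"

definition balanced ::
    "('a::real_vector \<Rightarrow> 'a \<Rightarrow> 'a) \<Rightarrow> ('a \<Rightarrow> 'a) \<Rightarrow> ('a \<Rightarrow> 'a \<Rightarrow> real) \<Rightarrow> bool" where
  "balanced br J g \<longleftrightarrow>
     (let n = dim (UNIV :: 'a set) div 2
      in \<forall>X. length X = 2 * n - 1 \<longrightarrow>
           ce_diff br (two_form_power (fundamental_form J g) (n - 1)) X = 0)"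

text \<open>Connections on left-invariant vector fields are bilinear maps on the Lie algebra; the
  two conditions besides bilinearity are compatibility with \<^term>\<open>g\<close> (functions
  \<^term>\<open>g Y Z\<close> being constant) and vanishing torsion.\<close>

definition levi_civita ::
    "('a::real_vector \<Rightarrow> 'a \<Rightarrow> 'a) \<Rightarrow> ('a \<Rightarrow> 'a \<Rightarrow> real) \<Rightarrow> 'a \<Rightarrow> 'a \<Rightarrow> 'a" where
  "levi_civita br g =
     (THE D. bilinear D \<and>
        (\<forall>X Y Z. g (D X Y) Z + g Y (D X Z) = 0) \<and>
        (\<forall>X Y. D X Y - D Y X = br X Y))"

definition canonical_connection ::
    "('a::real_vector \<Rightarrow> 'a \<Rightarrow> 'a) \<Rightarrow> ('a \<Rightarrow> 'a) \<Rightarrow> ('a \<Rightarrow> 'a \<Rightarrow> real) \<Rightarrow> real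
       \<Rightarrow> 'a \<Rightarrow> 'a \<Rightarrow> 'a" where
  "canonical_connection br J g \<tau> X Y =
     (let d\<omega> = ce_diff br (fundamental_form J g);
          T = (\<lambda>X Y Z. d\<omega> [J X, J Y, J Z]);
          C = (\<lambda>X Y Z. - d\<omega> [J X, Y, Z])
      in THE W. \<forall>Z. g W Z = g (levi_civita br g X Y) Z
                            + (1 - \<tau>) / 4 * T X Y Z + (1 + \<tau>) / 4 * C X Y Z)"

definition curvature ::
    "('a::real_vector \<Rightarrow> 'a \<Rightarrow> 'a) \<Rightarrow> ('a \<Rightarrow> 'a \<Rightarrow> 'a) \<Rightarrow> 'a \<Rightarrow> 'a \<Rightarrow> 'a \<Rightarrow> 'a" where
  "curvature br D X Y Z = D X (D Y Z) - D Y (D X Z) - D (br X Y) Z"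

definition orthonormal_basis ::
    "('a::real_vector \<Rightarrow> 'a \<Rightarrow> real) \<Rightarrow> (nat \<Rightarrow> 'a) \<Rightarrow> bool" where
  "orthonormal_basis g e \<longleftrightarrow>
     span (e ` {1..dim (UNIV :: 'a set)}) = UNIV \<and>
     (\<forall>i\<in>{1..dim (UNIV :: 'a set)}. \<forall>j\<in>{1..dim (UNIV :: 'a set)}.
        g (e i) (e j) = (if i = j then 1 else 0))"

text \<open>The Ricci form, computed in a given \<^term>\<open>g\<close>-orthonormal basis \<^term>\<open>e\<close>
  (on which its value does not depend).\<close>

definition ricci_form ::
    "('a::real_vector \<Rightarrow> 'a \<Rightarrow> 'a) \<Rightarrow> ('a \<Rightarrow> 'a) \<Rightarrow> ('a \<Rightarrow> 'a \<Rightarrow> real) \<Rightarrow> real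
       \<Rightarrow> (nat \<Rightarrow> 'a) \<Rightarrow> 'a \<Rightarrow> 'a \<Rightarrow> real" where
  "ricci_form br J g \<tau> e X Y =
     - (1 / 2) * (\<Sum>i = 1..dim (UNIV :: 'a set).
        g (curvature br (canonical_connection br J g \<tau>) X Y (e i)) (J (e i)))"

abbreviation bismut_ricci_form where
  "bismut_ricci_form br J g \<equiv> ricci_form br J g (-1)"

abbreviation chern_ricci_form where
  "chern_ricci_form br J g \<equiv> ricci_form br J g 1"

definition adapted_unitary_basis ::
    "('a::real_vector \<Rightarrow> 'a) \<Rightarrow> ('a \<Rightarrow> 'a \<Rightarrow> real) \<Rightarrow> 'a set \<Rightarrow> nat
       \<Rightarrow> (nat \<Rightarrow> 'a) \<Rightarrow> bool" where
  "adapted_unitary_basis J g N n e \<longleftrightarrow>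
     dim (UNIV :: 'a set) = 2 * n \<and> orthonormal_basis g e \<and>
     N = span (e ` {1..2 * n - 1}) \<and>
     N \<inter> J ` N = span (e ` {2..2 * n - 1}) \<and>
     (\<forall>i\<in>{1..n}. J (e i) = e (2 * n + 1 - i))"

definition dual_basis ::
    "nat \<Rightarrow> (nat \<Rightarrow> 'a::real_vector) \<Rightarrow> nat \<Rightarrow> 'a \<Rightarrow> real" where
  "dual_basis n e i X = representation (e ` {1..2 * n}) X (e i)"

text \<open>That \<open>ad e\<^sub>2\<^sub>n\<close> restricted to the ideal \<open>N\<close> has block matrix
  \<open>(a 0; v A)\<close> with respect to \<open>\<real>e\<^sub>1 \<oplus> N\<^sub>1\<close>, where \<open>N\<^sub>1 = N \<inter> J N\<close>. Only the values of
  \<open>A\<close> on \<open>N\<^sub>1\<close> are relevant. That \<open>A\<close> preserves \<open>N\<^sub>1\<close> and commutes with \<open>J\<close>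
  there is not assumed, as it follows (see \<open>algebraic_data_endomorphism\<close>).\<close>

definition algebraic_data ::
    "('a::real_vector \<Rightarrow> 'a \<Rightarrow> 'a) \<Rightarrow> ('a \<Rightarrow> 'a) \<Rightarrow> 'a set \<Rightarrow> nat \<Rightarrow> (nat \<Rightarrow> 'a)
       \<Rightarrow> real \<Rightarrow> 'a \<Rightarrow> ('a \<Rightarrow> 'a) \<Rightarrow> bool" where
  "algebraic_data br J N n e a v A \<longleftrightarrow>
     v \<in> N \<inter> J ` N \<and>
     br (e (2 * n)) (e 1) = a *\<^sub>R e 1 + v \<and>
     (\<forall>x \<in> N \<inter> J ` N. br (e (2 * n)) x = A x)"

lemma algebraic_data_endomorphism:
  assumes L: "lie_algebra br" and H: "hermitian_structure br J g"
    and N: "codim_one_abelian_ideal br N" and E: "adapted_unitary_basis J g N n e"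
    and D: "algebraic_data br J N n e a v A" and x: "x \<in> N \<inter> J ` N"
  shows "A x \<in> N \<inter> J ` N" and "A (J x) = J (A x)"
proof -
  have J2: "J (J y) = - y" and linJ: "linear J"
    and nij: "br (J x) (J y) - J (br (J x) y) - J (br x (J y)) - br x y = 0" for x y
    using H by (auto simp: hermitian_structure_def complex_structure_def)
  have subN: "subspace N" and idN: "\<And>x y. y \<in> N \<Longrightarrow> br x y \<in> N"
    and abN: "\<And>x y. x \<in> N \<Longrightarrow> y \<in> N \<Longrightarrow> br x y = 0"
    using N by (auto simp: codim_one_abelian_ideal_def abelian_ideal_def)
  have n1: "n \<ge> 1"
    using N E by (cases n) (auto simp: codim_one_abelian_ideal_def adapted_unitary_basis_def)
  have Je1: "J (e 1) = e (2 * n)" and e1N: "e 1 \<in> N"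
    using E n1 by (auto simp: adapted_unitary_basis_def intro!: span_base)
  have JxN: "J x \<in> N" and xN: "x \<in> N"
    using x subspace_neg[OF subN] J2 by (auto simp: image_iff)
  have Jx: "J x \<in> N \<inter> J ` N" using JxN xN by auto
  have lin: "br (c *\<^sub>R y + d *\<^sub>R y') z = c *\<^sub>R br y z + d *\<^sub>R br y' z"
      "br z (c *\<^sub>R y + d *\<^sub>R y') = c *\<^sub>R br z y + d *\<^sub>R br z y'" for c d y y' z
    using L by (auto simp: lie_algebra_on_def)
  have alt: "br y y = 0" for y using L by (auto simp: lie_algebra_on_def)
  have "br (y + z) (y + z) = br y y + br z y + (br y z + br z z)" for y z
    using lin(1)[of 1 y 1 z "y + z"] lin(2)[of y 1 y 1 z] lin(2)[of z 1 y 1 z]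
    by simp
  then have anti: "br y z = - br z y" for y z
    using alt[of y] alt[of z] alt[of "y + z"] by (simp add: eq_neg_iff_add_eq_0 add.commute)
  have Je: "J (e (2 * n)) = - e 1" using J2[of "e 1"] Je1 by simp
  have mN: "- e 1 \<in> N" using subspace_neg[OF subN e1N] .
  have "- J (br (J x) (e (2 * n))) - br x (e (2 * n)) = 0"
    using nij[of x "e (2 * n)"] abN[OF JxN mN] abN[OF xN mN] linear_0[OF linJ]
    unfolding Je by simp
  then have *: "J (br (e (2 * n)) (J x)) = - br (e (2 * n)) x"
    using anti[of "J x" "e (2 * n)"] anti[of x "e (2 * n)"]
    by (simp add: linear_neg[OF linJ] add_eq_0_iff)
  have A: "A x = br (e (2 * n)) x" "A (J x) = br (e (2 * n)) (J x)"
    using D x Jx by (auto simp: algebraic_data_def)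
  have "J (- A (J x)) = A x" using * A by (simp add: linear_neg[OF linJ])
  moreover have "- A (J x) \<in> N" "A x \<in> N"
    using A idN[OF JxN] idN[OF xN] subspace_neg[OF subN] by auto
  ultimately show "A x \<in> N \<inter> J ` N" by (metis IntI imageI)
  have "J (J (A (J x))) = J (- A x)" using * A by simp
  then show "A (J x) = J (A x)" by (simp add: J2 linear_neg[OF linJ])
qed

end

theory Submission
  imports Defs
begin

text \<open>Let \<open>D = ad e\<^sub>2\<^sub>n\<close>. All brackets have the form
  \<open>[x, y] = e\<^sup>2\<^sup>n(x) D y - e\<^sup>2\<^sup>n(y) D x\<close> with \<open>D\<close> taking values in the ideal, so
  \<open>d\<omega>\<^sup>n\<^sup>-\<^sup>1\<close> is \<open>- e\<^sup>2\<^sup>n\<close> wedged with the derivation action of \<open>D\<close> on \<open>\<omega>\<^sup>n\<^sup>-\<^sup>1\<close>. On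
  \<open>e\<^sub>2, \<dots>, e\<^sub>2\<^sub>n\<^sub>-\<^sub>1\<close> that action yields \<open>tr A\<close> times a positive number, and with \<open>e\<^sub>1\<close> replacing
  \<open>e\<^sub>i\<close> it yields the component of \<open>v\<close> along \<open>e\<^sub>i\<close>; everything else vanishes because \<open>e\<^sub>1\<close> spans the
  radical of \<open>\<omega>\<close> on the ideal.

  The Bismut and Chern connections commute with \<open>J\<close>, so \<open>\<rho>(X, Y)\<close> depends only on
  \<open>tr (J \<nabla>\<^sub>W)\<close> for \<open>W = [X, Y]\<close>, and the Koszul formula turns this into
  \<open>\<Sum> g([W, e\<^sub>i], J e\<^sub>i)\<close> and \<open>tr ad\<^bsub>J W\<^esub>\<close>, in the Bismut case also \<open>\<Sum> g([e\<^sub>i, J e\<^sub>i], W)\<close>.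
  Unimodularity means \<open>a + tr A = 0\<close>, hence in the balanced case \<open>a = 0\<close> and \<open>e\<^sub>1\<close> is central.\<close>

section \<open>Alternating forms as functions on lists\<close>

text \<open>A form is any function on lists, so alternation and multilinearity are carried as
  predicates about lists of length \<open>k\<close>; antisymmetry is asked only of neighbours, the
  case that suits list induction. The differential is a sum over pairs of indices. Cartan's formula
  turns it into a recursion on the list, from which its antisymmetry is read off. One direction of
  the criterion depends on that: vanishing on lists of basis vectors, in whatever order, must give
  vanishing everywhere. The value of the power of \<open>\<omega>\<close> on the middle basis
  vectors is never computed; it must only be nonzero, and this is seen from the signs of the
  summands. Connections given by \<open>THE\<close> are handled through their products with
  \<open>g\<close>, so that the Ricci forms become identities between trilinear real-valued forms.
  Since the last claim concerns all balanced structures and all orthonormal bases, adapted bases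
  have to be constructed and the Ricci form has to be shown independent of the basis.\<close>

definition swap_antisym :: "nat \<Rightarrow> 'a form \<Rightarrow> bool" where
  "swap_antisym k \<alpha> \<longleftrightarrow>
     (\<forall>U x y V. length U + length V + 2 = k \<longrightarrow> \<alpha> (U @ x # y # V) = - \<alpha> (U @ y # x # V))"

definition multilinear :: "nat \<Rightarrow> 'a::real_vector form \<Rightarrow> bool" where
  "multilinear k \<alpha> \<longleftrightarrow> (\<forall>X p. length X = k \<and> p < k \<longrightarrow> linear (\<lambda>x. \<alpha> (X[p := x])))"

text \<open>For alternating \<open>\<alpha>\<close>, minus the contraction by \<open>y\<close>. Both
  \<open>ce_diff\<close> and \<open>derivation_sum\<close> put a new vector in the first slot, so
  \<open>y\<close> has to wait in the second one. Only nonempty lists are ever supplied to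
  \<open>hd\<close> and \<open>tl\<close>.\<close>

definition insert_second :: "'a \<Rightarrow> 'a form \<Rightarrow> 'a form" where
  "insert_second y \<alpha> = (\<lambda>L. \<alpha> (hd L # y # tl L))"

text \<open>The derivation action of \<open>D\<close> on an alternating form; \<open>D (Y ! j)\<close> is moved to the front,
  which accounts for the sign.\<close>

definition derivation_sum :: "('a \<Rightarrow> 'a) \<Rightarrow> 'a form \<Rightarrow> 'a form" where
  "derivation_sum D \<alpha> = (\<lambda>Y. \<Sum>j<length Y. (-1) ^ j * \<alpha> (D (Y ! j) # nths Y (- {j})))"

lemma swap_antisymD:
  "swap_antisym k \<alpha> \<Longrightarrow> length U + length V + 2 = k \<Longrightarrow> \<alpha> (U @ x # y # V) = - \<alpha> (U @ y # x # V)"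
  unfolding swap_antisym_def by blast

lemma swap_antisym_Cons:
  "swap_antisym (Suc k) \<alpha> \<Longrightarrow> swap_antisym k (\<lambda>L. \<alpha> (w # L))"
  unfolding swap_antisym_def
proof (intro allI impI)
  fix U V :: "'a list" and x y
  assume *: "\<forall>U x y V. length U + length V + 2 = Suc k \<longrightarrow> \<alpha> (U @ x # y # V) = - \<alpha> (U @ y # x # V)"
    and k: "length U + length V + 2 = k"
  show "\<alpha> (w # U @ x # y # V) = - \<alpha> (w # U @ y # x # V)"
    using *[rule_format, of "w # U" V x y] k by simp
qed

lemma swap_antisym_move_front:
  assumes "swap_antisym k \<alpha>" "length U + length V + 1 = k"
  shows "\<alpha> (U @ x # V) = (-1) ^ length U * \<alpha> (x # U @ V)"
  using assms(2)
proof (induction U arbitrary: V rule: rev_induct)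
  case (snoc u U)
  have "\<alpha> ((U @ [u]) @ x # V) = - \<alpha> (U @ x # u # V)"
    using swap_antisymD[OF assms(1), of U V u x] snoc.prems by simp
  also have "\<dots> = - ((-1) ^ length U * \<alpha> (x # U @ u # V))"
    using snoc.IH[of "u # V"] snoc.prems by simp
  finally show ?case by simp
qed simp

text \<open>Both copies of the repeated vector travel to the front, where exchanging them turns
  \<open>\<alpha>\<close> into its own negative.\<close>

lemma swap_antisym_not_distinct:
  assumes "swap_antisym k \<alpha>" "length X = k" "\<not> distinct X"
  shows "\<alpha> X = (0::real)"
proof -
  obtain U V W x where X: "X = U @ [x] @ V @ [x] @ W"
    using not_distinct_decomp[OF assms(3)] by blast
  have "\<alpha> X = (-1) ^ length U * \<alpha> ((x # U @ V) @ x # W)"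
    using swap_antisym_move_front[OF assms(1), of U "V @ x # W" x] assms(2) X by auto
  also have "\<alpha> ((x # U @ V) @ x # W) = (-1) ^ Suc (length (U @ V)) * \<alpha> (x # x # U @ V @ W)"
    using swap_antisym_move_front[OF assms(1), of "x # U @ V" W x] assms(2) X by auto
  also have "\<alpha> (x # x # U @ V @ W) = 0"
    using swap_antisymD[OF assms(1), of "[]" "U @ V @ W" x x] assms(2) X by auto
  finally show ?thesis by simp
qed

lemma multilinear_head:
  assumes "multilinear k \<alpha>" "length Y + 1 = k"
  shows "linear (\<lambda>x. \<alpha> (x # Y))"
  using assms(1)[unfolded multilinear_def, rule_format, of "0 # Y" 0] assms(2) by simp

lemma multilinear_second:
  assumes "multilinear k \<alpha>" "length Y + 2 = k"
  shows "linear (\<lambda>x. \<alpha> (y # x # Y))"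
  using assms(1)[unfolded multilinear_def, rule_format, of "y # 0 # Y" 1] assms(2) by simp

lemma nths_omit:
  assumes "j < length X"
  shows "nths X (- {j}) = take j X @ drop (Suc j) X"
proof -
  have 1: "nths (take j X) (- {j}) = take j X"
    by (rule nths_all) auto
  have 2: "nths (drop (Suc j) X) {i. Suc (i + j) \<in> - {j}} = drop (Suc j) X"
    by (rule nths_all) auto
  have "nths (take j X @ X ! j # drop (Suc j) X) (- {j}) = take j X @ drop (Suc j) X"
    using assms 1 2 by (simp add: nths_append nths_Cons)
  then show ?thesis using id_take_nth_drop[OF assms] by simp
qed

text \<open>Cramer's rule, with \<open>w\<close> standing in for the entry \<open>L ! j\<close>. In
  the expansion of \<open>w\<close> every other term repeats a vector of \<open>L\<close> and
  vanishes; the sign accounts for carrying \<open>L ! j\<close> from the front back to its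
  place.\<close>

lemma alternating_contract:
  assumes sw: "swap_antisym k \<alpha>" and ml: "multilinear k \<alpha>" and k: "length L = k" and j: "j < k"
    and w: "w = (\<Sum>m<k. c m *\<^sub>R L ! m)"
  shows "\<alpha> (w # nths L (- {j})) = (-1) ^ j * c j * \<alpha> L"
proof -
  let ?R = "take j L @ drop (Suc j) L"
  have len: "length ?R + 1 = k" using j k by simp
  note lin = multilinear_head[OF ml len]
  have L: "L = take j L @ L ! j # drop (Suc j) L" by (rule id_take_nth_drop) (use j k in simp)
  have off: "\<alpha> (L ! m # ?R) = 0" if "m < k" "m \<noteq> j" for m
  proof (rule swap_antisym_not_distinct[OF sw])
    have "L ! m \<in> set ?R"
    proof (cases "m < j")
      case True
      then have "take j L ! m = L ! m" "m < length (take j L)" using k j by auto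
      then show ?thesis using nth_mem by (metis UnI1 set_append)
    next
      case False
      then have "drop (Suc j) L ! (m - Suc j) = L ! m" "m - Suc j < length (drop (Suc j) L)"
        using k j that by auto
      then show ?thesis using nth_mem by (metis UnI2 set_append)
    qed
    then show "\<not> distinct (L ! m # ?R)" by simp
  qed (use len in simp)
  have "\<alpha> (w # ?R) = (\<Sum>m<k. c m * \<alpha> (L ! m # ?R))"
    unfolding w by (simp add: linear_sum[OF lin] linear_scale[OF lin])
  also have "\<dots> = (\<Sum>m\<in>{j}. c m * \<alpha> (L ! m # ?R))"
    by (rule sum.mono_neutral_right) (use j off in auto)
  also have "\<dots> = c j * \<alpha> (L ! j # ?R)" by simp
  also have "\<alpha> (L ! j # ?R) = (-1) ^ j * \<alpha> L"
    using swap_antisym_move_front[OF sw, of "take j L" "drop (Suc j) L" "L ! j"] len L j k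
    by (simp add: power_mult_distrib[symmetric] mult.assoc[symmetric])
  finally show ?thesis using nths_omit[of j L] j k by simp
qed

text \<open>The term of index 0 acts on \<open>y\<close>. In all others \<open>y\<close> stays right
  behind the vector in front, and the shift of the index by one flips their sign.\<close>

lemma derivation_sum_Cons:
  "derivation_sum D \<alpha> (y # Y) = \<alpha> (D y # Y) - derivation_sum D (insert_second y \<alpha>) Y"
proof -
  have "nths (y # Y) (- {0}) = Y" "\<And>j. nths (y # Y) (- {Suc j}) = y # nths Y (- {j})"
    by (simp_all add: nths_Cons nths_all Compl_eq)
  then show ?thesis
    by (simp add: derivation_sum_def sum.lessThan_Suc_shift insert_second_def sum_negf
        del: sum.lessThan_Suc)
qed

section \<open>The derivation action and the Chevalley-Eilenberg differential under exchange of
  neighbours\<close>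

lemma derivation_sum_eq_minus:
  assumes "\<And>w L. Suc (length L) = length Y \<Longrightarrow> \<alpha> (w # L) = - \<beta> (w # L)"
  shows "derivation_sum D \<alpha> Y = - derivation_sum D \<beta> Y"
  unfolding derivation_sum_def sum_negf[symmetric]
proof (rule sum.cong)
  fix j assume "j \<in> {..<length Y}"
  then have "\<alpha> (D (Y ! j) # nths Y (- {j})) = - \<beta> (D (Y ! j) # nths Y (- {j}))"
    by (intro assms) (simp add: nths_omit)
  then show "(-1) ^ j * \<alpha> (D (Y ! j) # nths Y (- {j})) = - ((-1) ^ j * \<beta> (D (Y ! j) # nths Y (- {j})))"
    by simp
qed simp

text \<open>Antisymmetry is required behind the first slot, which is occupied by an image under
  \<open>D\<close>; in this form the hypothesis passes to \<open>insert_second u \<alpha>\<close>.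
  For empty \<open>U\<close> the two terms in which \<open>D\<close> hits \<open>x\<close> or
  \<open>y\<close> trade places.\<close>

lemma derivation_sum_swap:
  assumes "\<And>w. swap_antisym (Suc (length U + length V)) (\<lambda>L. \<alpha> (w # L))"
  shows "derivation_sum D \<alpha> (U @ x # y # V) = - derivation_sum D \<alpha> (U @ y # x # V)"
  using assms
proof (induction U arbitrary: \<alpha>)
  case Nil
  have "derivation_sum D (insert_second y (insert_second x \<alpha>)) V
      = - derivation_sum D (insert_second x (insert_second y \<alpha>)) V"
  proof (rule derivation_sum_eq_minus)
    fix w and L :: "'a list" assume "Suc (length L) = length V"
    then show "insert_second y (insert_second x \<alpha>) (w # L) = - insert_second x (insert_second y \<alpha>) (w # L)"
      using swap_antisymD[OF Nil.prems[of w], of "[]" L x y] by (simp add: insert_second_def)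
  qed
  then show ?case by (simp add: derivation_sum_Cons insert_second_def)
next
  case (Cons u U)
  have "swap_antisym (Suc (length U + length V)) (\<lambda>L. insert_second u \<alpha> (w # L))" for w
    using swap_antisym_Cons[of "Suc (length U + length V)" "\<lambda>L. \<alpha> (w # L)" u] Cons.prems
    by (simp add: insert_second_def)
  moreover have "\<alpha> (D u # U @ x # y # V) = - \<alpha> (D u # U @ y # x # V)"
    by (rule swap_antisymD[OF Cons.prems]) simp
  ultimately show ?case using Cons.IH[of "insert_second u \<alpha>"] by (simp add: derivation_sum_Cons)
qed

text \<open>Cartan's formula \<open>i_x d = L_x - d i_x\<close>. Pairs of indices containing 0 give
  the Lie derivative, which is minus the derivation action of \<open>br x\<close>; the others give
  the differential of the contracted form, whose sign is already inside
  \<open>insert_second\<close>.\<close>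

lemma ce_diff_Cons:
  "ce_diff br \<alpha> (x # Y) = - derivation_sum (br x) \<alpha> Y + ce_diff br (insert_second x \<alpha>) Y"
proof -
  have 1: "nths (x # Y) (- {0, Suc j}) = nths Y (- {j})" for j
    by (simp add: nths_Cons Compl_eq)
  have 2: "nths (x # Y) (- {Suc i, Suc j}) = x # nths Y (- {i, j})" for i j
    by (simp add: nths_Cons Compl_eq)
  show ?thesis
    by (simp add: ce_diff_def derivation_sum_def sum.lessThan_Suc_shift insert_second_def 1 2
        sum.distrib sum_negf sum_subtractf del: sum.lessThan_Suc)
qed

lemma ce_diff_Nil [simp]: "ce_diff br \<alpha> [] = 0"
  by (simp add: ce_diff_def)

lemma length_nths_omit2:
  assumes "i < j" "j < length X" shows "length (nths X (- {i, j})) + 2 = length X"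
proof -
  have "{k. k < length X \<and> k \<in> - {i, j}} = {..<length X} - {i, j}" by auto
  moreover have "card {i, j} = 2" using assms by simp
  ultimately show ?thesis using assms card_Diff_subset[of "{i, j}" "{..<length X}"]
    by (simp add: length_nths)
qed

lemma ce_diff_eq_minus:
  assumes "\<And>w L. length L + 2 = length X \<Longrightarrow> \<alpha> (w # L) = - \<beta> (w # L)"
  shows "ce_diff br \<alpha> X = - ce_diff br \<beta> X"
proof -
  have "(-1) ^ (i + j) * \<alpha> (br (X ! i) (X ! j) # nths X (- {i, j}))
      = - ((-1) ^ (i + j) * \<beta> (br (X ! i) (X ! j) # nths X (- {i, j})))"
    if "i < j" "j < length X" for i j
    using assms[OF length_nths_omit2[OF that]] by simp
  then show ?thesis unfolding ce_diff_def sum_negf[symmetric]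
    by (intro sum.cong) auto
qed

text \<open>Unfolding twice leaves the value on the bracket of \<open>x\<close> and
  \<open>y\<close>, which is antisymmetric by linearity in the first slot, two derivation terms that
  trade places, and the differential of a doubly contracted form.\<close>

lemma ce_diff_swap:
  assumes anti: "\<And>x y. br x y = - br y x"
    and "\<And>w. swap_antisym (length U + length V) (\<lambda>L. \<alpha> (w # L))"
    and "\<And>L. length L = length U + length V \<Longrightarrow> linear (\<lambda>w. \<alpha> (w # L))"
  shows "ce_diff br \<alpha> (U @ x # y # V) = - ce_diff br \<alpha> (U @ y # x # V)"
  using assms(2,3)
proof (induction U arbitrary: \<alpha>)
  case Nil
  have "ce_diff br (insert_second y (insert_second x \<alpha>)) V
      = - ce_diff br (insert_second x (insert_second y \<alpha>)) V"
  proof (rule ce_diff_eq_minus)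
    fix w and L :: "'a list" assume "length L + 2 = length V"
    then show "insert_second y (insert_second x \<alpha>) (w # L) = - insert_second x (insert_second y \<alpha>) (w # L)"
      using swap_antisymD[OF Nil.prems(1)[of w], of "[]" L x y] by (simp add: insert_second_def)
  qed
  moreover have "\<alpha> (br x y # V) = - \<alpha> (br y x # V)"
    using linear_neg[OF Nil.prems(2)[of V], of "br y x"] anti[of x y] by simp
  ultimately show ?case by (simp add: derivation_sum_Cons ce_diff_Cons)
next
  case (Cons u U)
  have "swap_antisym (length U + length V) (\<lambda>L. insert_second u \<alpha> (w # L))" for w
    using swap_antisym_Cons[of "length U + length V" "\<lambda>L. \<alpha> (w # L)" u] Cons.prems(1)
    by (simp add: insert_second_def)
  moreover have "linear (\<lambda>w. insert_second u \<alpha> (w # L))" if "length L = length U + length V" for L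
    using Cons.prems(2)[of "u # L"] that by (simp add: insert_second_def)
  moreover have "derivation_sum (br u) \<alpha> (U @ x # y # V) = - derivation_sum (br u) \<alpha> (U @ y # x # V)"
    by (rule derivation_sum_swap) (use Cons.prems(1) in simp)
  ultimately show ?case using Cons.IH[of "insert_second u \<alpha>"] by (simp add: ce_diff_Cons)
qed

lemma swap_antisym_ce_diff:
  assumes anti: "\<And>x y. br x y = - br y x"
    and sw: "swap_antisym (Suc k) \<alpha>" and ml: "multilinear (Suc k) \<alpha>"
  shows "swap_antisym (Suc (Suc k)) (ce_diff br \<alpha>)"
  unfolding swap_antisym_def
proof (intro allI impI)
  fix U V :: "'a list" and x y assume *: "length U + length V + 2 = Suc (Suc k)"
  show "ce_diff br \<alpha> (U @ x # y # V) = - ce_diff br \<alpha> (U @ y # x # V)"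
  proof (rule ce_diff_swap[OF anti])
    show "swap_antisym (length U + length V) (\<lambda>L. \<alpha> (w # L))" for w
      using swap_antisym_Cons[OF sw] * by simp
    show "linear (\<lambda>w. \<alpha> (w # L))" if "length L = length U + length V" for L
      using multilinear_head[OF ml] that * by simp
  qed
qed

lemma linear_real_sum:
  "(\<And>i. i \<in> I \<Longrightarrow> linear (f i)) \<Longrightarrow> linear (\<lambda>x. \<Sum>i\<in>I. (f i x :: real))"
  by (rule linear_compose_sum) blast

lemma linear_real_cmult: "linear f \<Longrightarrow> linear (\<lambda>x. c * (f x :: real))"
  using linear_compose_scale_right[of f c] by simp

lemma ce_diff_head_linear:
  assumes br: "bilinear br" and ml: "multilinear (Suc k) \<alpha>" and Y: "length Y = Suc k"
  shows "linear (\<lambda>x. ce_diff br \<alpha> (x # Y))"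
proof -
  have "linear (\<lambda>x. (-1) ^ j * \<alpha> (br x (Y ! j) # nths Y (- {j})))" if "j < length Y" for j
  proof (rule linear_real_cmult)
    have "linear (\<lambda>x. br x (Y ! j))" using br by (simp add: bilinear_def)
    from linear_compose[OF this multilinear_head[OF ml, of "nths Y (- {j})"]]
    show "linear (\<lambda>x. \<alpha> (br x (Y ! j) # nths Y (- {j})))"
      using that Y by (simp add: nths_omit o_def)
  qed
  then have 1: "linear (\<lambda>x. - derivation_sum (br x) \<alpha> Y)"
    unfolding derivation_sum_def by (intro linear_compose_neg linear_real_sum) auto
  have "linear (\<lambda>x. (-1) ^ (i + j) * insert_second x \<alpha> (br (Y ! i) (Y ! j) # nths Y (- {i, j})))"
    if "i < j" "j < length Y" for i j
    unfolding insert_second_def list.sel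
    by (intro linear_real_cmult multilinear_second[OF ml])
       (use length_nths_omit2[OF that] Y in simp)
  then have 2: "linear (\<lambda>x. ce_diff br (insert_second x \<alpha>) Y)"
    unfolding ce_diff_def by (intro linear_real_sum) auto
  show ?thesis unfolding ce_diff_Cons by (rule linear_compose_add[OF 1 2])
qed

text \<open>Any argument can be brought to the first slot, so linearity there does the work of
  multilinearity.\<close>

lemma alternating_eq_0_spanning:
  assumes sw: "swap_antisym k \<alpha>"
    and lin: "\<And>Y. length Y + 1 = k \<Longrightarrow> linear (\<lambda>x. \<alpha> (x # Y))"
    and span: "span S = UNIV"
    and zero: "\<And>X. length X = k \<Longrightarrow> set X \<subseteq> S \<Longrightarrow> \<alpha> X = 0"
    and X: "length X = k"
  shows "\<alpha> X = (0::real)"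
proof -
  \<comment> \<open>The prefix \<open>B\<close> consists of vectors of \<open>S\<close>, while
    \<open>Z\<close> is still arbitrary. The head of \<open>Z\<close> goes to the front, is reduced
    by linearity to vectors of \<open>S\<close>, and joins the prefix.\<close>
  have "\<alpha> (B @ Z) = 0" if "set B \<subseteq> S" "length B + length Z = k" for B Z
    using that
  proof (induction Z arbitrary: B)
    case (Cons z Z)
    have "\<alpha> (x # B @ Z) = 0" for x
    proof (rule linear_eq_0_on_span[where b = S and f = "\<lambda>x. \<alpha> (x # B @ Z)"])
      show "linear (\<lambda>x. \<alpha> (x # B @ Z))" by (rule lin) (use Cons.prems in simp)
      show "\<alpha> (s # B @ Z) = 0" if "s \<in> S" for s
        using Cons.IH[of "s # B"] Cons.prems that by simp
    qed (simp add: span)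
    then show ?case
      using swap_antisym_move_front[OF sw, of B Z z] Cons.prems by simp
  qed (use zero in simp)
  from this[of "[]" X] X show ?thesis by simp
qed

section \<open>Powers of a two-form\<close>

text \<open>The sum over all permutations is reindexed by \<open>\<tau> \<circ> \<sigma>\<close>,
  and multiplicativity of the sign pulls out \<open>sign \<tau>\<close>.\<close>

lemma wedge_permute:
  assumes \<tau>: "\<tau> permutes {..<p + q}" and X': "\<And>i. i < p + q \<Longrightarrow> X' ! i = X ! \<tau> i"
  shows "wedge p q \<alpha> \<beta> X' = of_int (sign \<tau>) * wedge p q \<alpha> \<beta> X"
proof -
  let ?S = "{..<p + q}"
  let ?F = "\<lambda>X \<sigma>. of_int (sign \<sigma>) * \<alpha> (map (\<lambda>i. X ! \<sigma> i) [0..<p])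
                        * \<beta> (map (\<lambda>i. X ! \<sigma> i) [p..<p + q]) :: real"
  have "(\<Sum>\<sigma> | \<sigma> permutes ?S. ?F X' \<sigma>) = (\<Sum>\<sigma> | \<sigma> permutes ?S. of_int (sign \<tau>) * ?F X (\<tau> \<circ> \<sigma>))"
  proof (rule sum.cong)
    fix \<sigma> assume "\<sigma> \<in> {\<sigma>. \<sigma> permutes ?S}"
    then have \<sigma>: "\<sigma> permutes ?S" by simp
    have im: "\<sigma> i < p + q" if "i < p + q" for i
      using permutes_in_image[OF \<sigma>, of i] that by simp
    have 1: "map (\<lambda>i. X' ! \<sigma> i) [0..<p] = map (\<lambda>i. X ! (\<tau> \<circ> \<sigma>) i) [0..<p]"
      and 2: "map (\<lambda>i. X' ! \<sigma> i) [p..<p + q] = map (\<lambda>i. X ! (\<tau> \<circ> \<sigma>) i) [p..<p + q]"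
      using X' im by auto
    have "sign (\<tau> \<circ> \<sigma>) = sign \<tau> * sign \<sigma>"
      using \<tau> \<sigma> by (intro sign_compose) (auto simp: permutation_permutes)
    then have "real_of_int (sign \<tau>) * of_int (sign (\<tau> \<circ> \<sigma>)) = of_int (sign \<sigma>)"
      by (metis mult.assoc mult_1 of_int_mult sign_idempotent)
    then show "?F X' \<sigma> = of_int (sign \<tau>) * ?F X (\<tau> \<circ> \<sigma>)"
      unfolding 1 2 by (metis mult.assoc)
  qed simp
  also have "\<dots> = of_int (sign \<tau>) * (\<Sum>\<sigma> | \<sigma> permutes ?S. ?F X \<sigma>)"
    unfolding sum_distrib_left[symmetric]
    by (simp only: setum_permutations_compose_left[OF \<tau>, of "?F X"])
  finally show ?thesis by (simp add: wedge_def)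
qed

lemma swap_antisym_wedge: "swap_antisym (p + q) (wedge p q \<alpha> \<beta>)"
  unfolding swap_antisym_def
proof (intro allI impI)
  fix U V :: "'a list" and x y assume len: "length U + length V + 2 = p + q"
  let ?t = "Transposition.transpose (length U) (Suc (length U))"
  have "wedge p q \<alpha> \<beta> (U @ x # y # V) = of_int (sign ?t) * wedge p q \<alpha> \<beta> (U @ y # x # V)"
  proof (rule wedge_permute)
    show "?t permutes {..<p + q}" by (rule permutes_swap_id) (use len in auto)
    show "(U @ x # y # V) ! i = (U @ y # x # V) ! ?t i" for i
      by (auto simp: nth_append nth_Cons Transposition.transpose_def split: nat.split)
  qed
  then show "wedge p q \<alpha> \<beta> (U @ x # y # V) = - wedge p q \<alpha> \<beta> (U @ y # x # V)"
    by (simp add: sign_swap_id)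
qed

lemma multilinear_wedge:
  assumes \<alpha>: "multilinear p \<alpha>" and \<beta>: "multilinear q \<beta>"
  shows "multilinear (p + q) (wedge p q \<alpha> \<beta>)"
  unfolding multilinear_def
proof (intro allI impI)
  fix X :: "'a list" and r assume "length X = p + q \<and> r < p + q"
  then have len: "length X = p + q" and r: "r < p + q" by auto
  have "linear (\<lambda>x. of_int (sign \<sigma>) * \<alpha> (map (\<lambda>i. X[r := x] ! \<sigma> i) [0..<p])
                        * \<beta> (map (\<lambda>i. X[r := x] ! \<sigma> i) [p..<p + q]))"
    if \<sigma>: "\<sigma> permutes {..<p + q}" for \<sigma>
  proof -
    \<comment> \<open>The permuted list reads slot \<open>r\<close> exactly once, at
      \<open>s\<close>. Linearity then comes from \<open>\<alpha>\<close> or from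
      \<open>\<beta>\<close>, according to the block in which \<open>s\<close> lies.\<close>
    obtain s where s: "\<sigma> s = r" by (metis \<sigma> permutes_def)
    then have sl: "s < p + q" using permutes_in_image[OF \<sigma>, of s] r by simp
    have eq: "\<sigma> i = r \<longleftrightarrow> i = s" for i using s \<sigma> by (metis permutes_def)
    have im: "\<sigma> i < length X" if "i < p + q" for i
      using permutes_in_image[OF \<sigma>, of i] that len by simp
    have nth: "X[r := x] ! \<sigma> i = (if i = s then x else X ! \<sigma> i)" if "i < p + q" for i x
      using im[OF that] eq[of i] s by (auto simp: nth_list_update)
    show ?thesis
    proof (cases "s < p")
      case True
      have 1: "map (\<lambda>i. X[r := x] ! \<sigma> i) [0..<p] = (map (\<lambda>i. X ! \<sigma> i) [0..<p])[s := x]" for x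
        by (rule nth_equalityI) (auto simp: nth nth_list_update)
      have 2: "map (\<lambda>i. X[r := x] ! \<sigma> i) [p..<p + q] = map (\<lambda>i. X ! \<sigma> i) [p..<p + q]" for x
        using True by (auto simp: nth)
      have "linear (\<lambda>x. \<alpha> ((map (\<lambda>i. X ! \<sigma> i) [0..<p])[s := x]))"
        using \<alpha> True by (simp add: multilinear_def)
      from linear_real_cmult[OF this, of "of_int (sign \<sigma>) * \<beta> (map (\<lambda>i. X ! \<sigma> i) [p..<p + q])"]
      show ?thesis unfolding 1 2 by (simp add: mult_ac)
    next
      case False
      have 1: "map (\<lambda>i. X[r := x] ! \<sigma> i) [0..<p] = map (\<lambda>i. X ! \<sigma> i) [0..<p]" for x
        using False by (auto simp: nth)
      have 2: "map (\<lambda>i. X[r := x] ! \<sigma> i) [p..<p + q] = (map (\<lambda>i. X ! \<sigma> i) [p..<p + q])[s - p := x]" for x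
        by (rule nth_equalityI) (use False in \<open>auto simp: nth nth_list_update\<close>)
      have "linear (\<lambda>x. \<beta> ((map (\<lambda>i. X ! \<sigma> i) [p..<p + q])[s - p := x]))"
        using \<beta> False sl by (simp add: multilinear_def)
      from linear_real_cmult[OF this, of "of_int (sign \<sigma>) * \<alpha> (map (\<lambda>i. X ! \<sigma> i) [0..<p])"]
      show ?thesis unfolding 1 2 by (simp add: mult_ac)
    qed
  qed
  from linear_real_cmult[OF linear_real_sum, of "{\<sigma>. \<sigma> permutes {..<p + q}}", OF this,
      of _ "1 / (fact p * fact q)"]
  show "linear (\<lambda>x. wedge p q \<alpha> \<beta> (X[r := x]))"
    unfolding wedge_def by simp
qed

lemma multilinear_two_form:
  assumes "bilinear \<beta>" shows "multilinear 2 (two_form \<beta>)"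
  unfolding multilinear_def
proof (intro allI impI)
  fix X :: "'a list" and p :: nat assume *: "length X = 2 \<and> p < 2"
  then consider "p = 0" | "p = 1" by linarith
  then show "linear (\<lambda>x. two_form \<beta> (X[p := x]))"
    using assms * by cases (auto simp: two_form_def bilinear_def)
qed

lemma multilinear_two_form_power:
  "bilinear \<beta> \<Longrightarrow> multilinear (2 * k) (two_form_power (two_form \<beta>) k)"
proof (induction k)
  case 0
  then show ?case by (simp add: multilinear_def)
next
  case (Suc k)
  then show ?case using multilinear_wedge[OF multilinear_two_form, of \<beta> "2 * k"] by simp
qed

lemma swap_antisym_two_form_power: "swap_antisym (2 * k) (two_form_power \<beta> k)"
proof (cases k)
  case 0
  then show ?thesis by (simp add: swap_antisym_def)
next
  case (Suc j)
  then show ?thesis using swap_antisym_wedge[of 2 "2 * j" \<beta>] by simp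
qed

section \<open>Vanishing and positivity of powers of a two-form\<close>

lemma upt_2: "[0..<2] = [0, 1::nat]"
  by (simp add: upt_rec)

text \<open>In every summand \<open>x\<close> is an argument either of the factor
  \<open>\<beta>\<close> that is split off or of the remaining power. Only pairings with members of
  \<open>X\<close> have to vanish: \<open>e 1\<close> is radical on the ideal, but it pairs with
  \<open>e (2 * n)\<close>.\<close>

lemma two_form_power_radical:
  assumes "x \<in> set X" "length X = 2 * k" "\<And>y. y \<in> set X \<Longrightarrow> \<beta> x y = 0 \<and> \<beta> y x = 0"
  shows "two_form_power (two_form \<beta>) k X = 0"
  using assms
proof (induction k arbitrary: X)
  case (Suc k)
  have "two_form \<beta> (map (\<lambda>i. X ! \<sigma> i) [0..<2])
      * two_form_power (two_form \<beta>) k (map (\<lambda>i. X ! \<sigma> i) [2..<2 + 2 * k]) = 0"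
    if \<sigma>: "\<sigma> permutes {..<2 + 2 * k}" for \<sigma>
  proof -
    obtain r where r: "r < 2 + 2 * k" "X ! r = x"
      using Suc.prems(1,2) by (auto simp: in_set_conv_nth)
    obtain s where s: "\<sigma> s = r" by (metis \<sigma> permutes_def)
    then have sl: "s < 2 + 2 * k" using permutes_in_image[OF \<sigma>, of s] r by simp
    have mem: "X ! \<sigma> i \<in> set X" if "i < 2 + 2 * k" for i
      using permutes_in_image[OF \<sigma>, of i] that Suc.prems(2) by simp
    show ?thesis
    proof (cases "s < 2")
      case True
      then consider "s = 0" | "s = 1" by linarith
      then have "\<beta> (X ! \<sigma> 0) (X ! \<sigma> 1) = 0"
        using Suc.prems(3) mem[of 0] mem[of 1] r s by cases auto
      then show ?thesis by (simp add: two_form_def upt_2)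
    next
      case False
      have "two_form_power (two_form \<beta>) k (map (\<lambda>i. X ! \<sigma> i) [2..<2 + 2 * k]) = 0"
      proof (rule Suc.IH)
        show "x \<in> set (map (\<lambda>i. X ! \<sigma> i) [2..<2 + 2 * k])"
          unfolding set_map set_upt using False sl s r by (intro image_eqI[of _ _ s]) auto
        show "\<beta> x y = 0 \<and> \<beta> y x = 0" if "y \<in> set (map (\<lambda>i. X ! \<sigma> i) [2..<2 + 2 * k])" for y
          using that by (intro Suc.prems(3)) (use mem in auto)
      qed (simp del: upt_Suc)
      then show ?thesis by simp
    qed
  qed
  then show ?case
    by (auto simp: wedge_def mult.assoc simp del: upt_Suc intro!: sum.neutral)
qed simp

lemma swap_antisym_transposition:
  assumes sw: "swap_antisym k \<alpha>" and len: "length U + length V + length W + 2 = k"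
  shows "\<alpha> (U @ x # V @ y # W) = - \<alpha> (U @ y # V @ x # W)"
proof -
  have *: "\<alpha> (U @ x # V @ y # W) = (-1) ^ length U * ((-1) ^ Suc (length (U @ V)) * \<alpha> (y # x # U @ V @ W))" for x y
  proof -
    have "\<alpha> (U @ x # V @ y # W) = (-1) ^ length U * \<alpha> ((x # U @ V) @ y # W)"
      using swap_antisym_move_front[OF sw, of U "V @ y # W" x] len by simp
    also have "\<alpha> ((x # U @ V) @ y # W) = (-1) ^ Suc (length (U @ V)) * \<alpha> (y # x # U @ V @ W)"
      using swap_antisym_move_front[OF sw, of "x # U @ V" W y] len by simp
    finally show ?thesis .
  qed
  have "\<alpha> (y # x # U @ V @ W) = - \<alpha> (x # y # U @ V @ W)"
    using swap_antisymD[OF sw, of "[]" "U @ V @ W" y x] len by simp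
  then show ?thesis unfolding *[of x y] *[of y x] by simp
qed

text \<open>Positions start at \<open>p\<close> because the second factor of a wedge product reads
  the list from there. The general \<open>f\<close> lets the induction absorb each
  transposition.\<close>

lemma swap_antisym_permute:
  assumes sw: "swap_antisym q \<alpha>" and \<sigma>: "\<sigma> permutes {p..<p + q}"
  shows "\<alpha> (map (\<lambda>i. f (\<sigma> i)) [p..<p + q]) = of_int (sign \<sigma>) * \<alpha> (map f [p..<p + q])"
  using \<sigma> finite_atLeastLessThan
proof (induction \<sigma> arbitrary: f rule: permutes_induct)
  case id
  then show ?case by (simp add: sign_id)
next
  case (swap a b \<sigma>)
  have step: "\<alpha> (map (\<lambda>i. f (Transposition.transpose a b i)) [p..<p + q]) = - \<alpha> (map f [p..<p + q])"
    if "a < b" "p \<le> a" "b < p + q" for a b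
  proof -
    have "[p..<p + q] = [p..<a] @ [a..<p + q]"
      using that upt_add_eq_append[of p a "p + q - a"] by simp
    also have "[a..<p + q] = a # [Suc a..<b] @ [b..<p + q]"
      using that upt_add_eq_append[of "Suc a" b "p + q - b"] by (simp add: upt_conv_Cons)
    also have "[b..<p + q] = b # [Suc b..<p + q]"
      using that by (simp add: upt_conv_Cons)
    finally have split: "[p..<p + q] = [p..<a] @ a # [Suc a..<b] @ b # [Suc b..<p + q]" .
    have "map (\<lambda>i. f (Transposition.transpose a b i)) [p..<p + q]
        = map f [p..<a] @ f b # map f [Suc a..<b] @ f a # map f [Suc b..<p + q]"
      unfolding split using that by (auto simp: Transposition.transpose_def)
    moreover have "map f [p..<p + q]
        = map f [p..<a] @ f a # map f [Suc a..<b] @ f b # map f [Suc b..<p + q]"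
      unfolding split by simp
    moreover have "\<alpha> (map f [p..<a] @ f b # map f [Suc a..<b] @ f a # map f [Suc b..<p + q])
        = - \<alpha> (map f [p..<a] @ f a # map f [Suc a..<b] @ f b # map f [Suc b..<p + q])"
      by (rule swap_antisym_transposition[OF sw]) (use that in simp)
    ultimately show ?thesis by simp
  qed
  have "\<alpha> (map (\<lambda>i. f (Transposition.transpose a b i)) [p..<p + q]) = - \<alpha> (map f [p..<p + q])"
    using step[of a b] step[of b a] swap.hyps by (cases "a < b") (auto simp: Transposition.transpose_commute)
  moreover have "sign (Transposition.transpose a b \<circ> \<sigma>) = - sign \<sigma>"
    using swap.hyps sign_compose[OF permutation_swap_id, of \<sigma> a b]
    by (auto simp: sign_swap_id permutation_permutes)
  ultimately show ?case
    using swap.IH[of "\<lambda>i. f (Transposition.transpose a b i)"] by (simp add: o_def)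
qed

text \<open>Lists of symplectic pairs \<open>x\<^sub>1, J x\<^sub>1, x\<^sub>2, J x\<^sub>2, \<dots>\<close>.\<close>

definition standard_list :: "('a \<Rightarrow> 'a \<Rightarrow> real) \<Rightarrow> nat \<Rightarrow> 'a list \<Rightarrow> bool" where
  "standard_list \<beta> k L \<longleftrightarrow> length L = 2 * k \<and>
     (\<forall>i<2 * k. \<forall>j<2 * k. \<beta> (L ! i) (L ! j) =
        (if i div 2 = j div 2 then (if odd j then 1 else 0) - (if odd i then 1 else 0) else 0))"

lemma standard_list_nth:
  "standard_list \<beta> k L \<Longrightarrow> i < 2 * k \<Longrightarrow> j < 2 * k \<Longrightarrow> \<beta> (L ! i) (L ! j) =
        (if i div 2 = j div 2 then (if odd j then 1 else 0) - (if odd i then 1 else 0) else 0)"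
  by (simp add: standard_list_def)

lemma standard_list_drop:
  "standard_list \<beta> (Suc k) L \<Longrightarrow> standard_list \<beta> k (drop 2 L)"
  by (auto simp: standard_list_def)

text \<open>Exchanges the front pair with the \<open>r\<close>-th pair as a block. It is even, being
  made of two transpositions (the identity if \<open>r = 0\<close>).\<close>

definition swap_pair :: "nat \<Rightarrow> nat \<Rightarrow> nat" where
  "swap_pair r = Transposition.transpose 0 (2 * r) \<circ> Transposition.transpose 1 (Suc (2 * r))"

lemma swap_pair_cases:
  "swap_pair r i = (if i = 0 then 2 * r else if i = 1 then Suc (2 * r) else if i = 2 * r then 0
     else if i = Suc (2 * r) then 1 else i)"
  by (auto simp: swap_pair_def Transposition.transpose_def)

lemma swap_pair_div: "swap_pair r i div 2 = Transposition.transpose 0 r (i div 2)"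
  by (auto simp: swap_pair_cases Transposition.transpose_def)

lemma odd_swap_pair: "odd (swap_pair r i) = odd i"
  by (auto simp: swap_pair_cases)

lemma swap_pair_involutive: "swap_pair r (swap_pair r i) = i"
  by (auto simp: swap_pair_cases)

lemma swap_pair_permutes: "r < k \<Longrightarrow> swap_pair r permutes {..<2 * k}"
  unfolding swap_pair_def by (intro permutes_compose permutes_swap_id) auto

lemma sign_swap_pair: "sign (swap_pair r) = 1"
  by (simp add: swap_pair_def sign_compose permutation_swap_id sign_swap_id)

text \<open>No two permutations cancel: if \<open>\<sigma> 0\<close> and \<open>\<sigma> 1\<close> form a pair, that pair is moved to the front
  by an even permutation, which reduces to the case \<open>{\<sigma> 0, \<sigma> 1} = {0, 1}\<close>.\<close>

lemma two_form_power_standard_list_pos: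
  "standard_list \<beta> k L \<Longrightarrow> two_form_power (two_form \<beta>) k L > 0"
proof (induction k arbitrary: L)
  case (Suc k)
  let ?P = "two_form_power (two_form \<beta>) k"
  define T where "T L \<sigma> = of_int (sign \<sigma>) * \<beta> (L ! \<sigma> 0) (L ! \<sigma> 1)
      * ?P (map (\<lambda>i. L ! \<sigma> i) [2..<2 + 2 * k])" for L \<sigma>
  have first: "T L \<sigma> > 0"
    if L: "standard_list \<beta> (Suc k) L" and \<sigma>: "\<sigma> permutes {..<2 + 2 * k}"
      and d: "\<sigma> 0 div 2 = 0" "\<sigma> 1 div 2 = 0" for L \<sigma>
  proof -
    have ne: "\<sigma> 0 \<noteq> \<sigma> 1" by (simp add: inj_eq[OF permutes_inj[OF \<sigma>]])
    have "\<sigma> 0 < 2" "\<sigma> 1 < 2" using d by auto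
    then consider "\<sigma> 0 = 0" "\<sigma> 1 = 1" | "\<sigma> 0 = 1" "\<sigma> 1 = 0" using ne by linarith
    \<comment> \<open>\<open>\<tau>\<close> is \<open>\<sigma>\<close> corrected so as to fix 0 and
      1. If \<open>\<sigma>\<close> exchanges them, the sign of the permutation and the sign of
      \<open>\<beta>\<close> change together.\<close>
    then obtain \<tau> where \<tau>: "\<tau> permutes {..<2 + 2 * k}" "\<tau> 0 = 0" "\<tau> 1 = 1"
      and \<tau>\<sigma>: "\<And>i. i \<ge> 2 \<Longrightarrow> \<tau> i = \<sigma> i"
      and sg: "of_int (sign \<sigma>) * \<beta> (L ! \<sigma> 0) (L ! \<sigma> 1) = real_of_int (sign \<tau>)"
    proof cases
      case 1
      have "\<beta> (L ! 0) (L ! 1) = 1" using standard_list_nth[OF L, of 0 1] by simp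
      then show ?thesis by (intro that[OF \<sigma> 1]) (simp_all only: 1 mult_1_right)
    next
      case 2
      have t: "Transposition.transpose 0 1 permutes {..<2 + 2 * k}" by (rule permutes_swap_id) auto
      have big: "\<sigma> i \<noteq> 0 \<and> \<sigma> i \<noteq> 1" if "i \<ge> 2" for i
      proof -
        have "\<sigma> i \<noteq> \<sigma> 0" "\<sigma> i \<noteq> \<sigma> 1" using that by (auto simp: inj_eq[OF permutes_inj[OF \<sigma>]])
        then show ?thesis using 2 by simp
      qed
      have "sign (Transposition.transpose 0 1 \<circ> \<sigma>) = - sign \<sigma>"
        using \<sigma> sign_compose[OF permutation_swap_id, of \<sigma> 0 1]
        by (auto simp: sign_swap_id permutation_permutes)
      moreover have "\<beta> (L ! 1) (L ! 0) = - 1" using standard_list_nth[OF L, of 1 0] by simp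
      ultimately show ?thesis
        by (intro that[OF permutes_compose[OF \<sigma> t]])
           (use 2 big in \<open>simp_all add: Transposition.transpose_def\<close>)
    qed
    have "\<tau> permutes {2..<2 + 2 * k}"
      by (rule permutes_superset[OF \<tau>(1)]) (use \<tau>(2,3) in \<open>auto simp: less_2_cases_iff not_le\<close>)
    then have "?P (map (\<lambda>i. L ! \<tau> i) [2..<2 + 2 * k]) = of_int (sign \<tau>) * ?P (map ((!) L) [2..<2 + 2 * k])"
      by (rule swap_antisym_permute[OF swap_antisym_two_form_power])
    moreover have "map ((!) L) [2..<2 + 2 * k] = drop 2 L"
      using L by (intro nth_equalityI) (auto simp: standard_list_def simp del: upt_Suc)
    moreover have "map (\<lambda>i. L ! \<sigma> i) [2..<2 + 2 * k] = map (\<lambda>i. L ! \<tau> i) [2..<2 + 2 * k]"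
      using \<tau>\<sigma> by (simp del: upt_Suc)
    \<comment> \<open>The sign of \<open>\<tau>\<close> occurs twice, once from the wedge product
      and once from the antisymmetry of the remaining power.\<close>
    ultimately have "T L \<sigma> = of_int (sign \<tau>) * (of_int (sign \<tau>) * ?P (drop 2 L))"
      unfolding T_def sg by (simp only:)
    also have "\<dots> = ?P (drop 2 L)"
      by (metis mult.assoc mult_1 of_int_1 of_int_mult sign_idempotent)
    finally show ?thesis using Suc.IH[OF standard_list_drop[OF L]] by simp
  qed
  have nonneg: "T L \<sigma> \<ge> 0" if \<sigma>: "\<sigma> permutes {..<2 + 2 * k}" for \<sigma>
  proof (cases "\<sigma> 0 div 2 = \<sigma> 1 div 2")
    case False
    have "\<sigma> 0 < 2 * Suc k" "\<sigma> 1 < 2 * Suc k"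
      using permutes_in_image[OF \<sigma>, of 0] permutes_in_image[OF \<sigma>, of 1] by auto
    then show ?thesis using standard_list_nth[OF Suc.prems] False by (simp add: T_def)
  next
    case True
    define r where "r = \<sigma> 0 div 2"
    define M where "M = map (\<lambda>i. L ! swap_pair r i) [0..<2 + 2 * k]"
    have "\<sigma> 0 < 2 + 2 * k" using permutes_in_image[OF \<sigma>, of 0] by simp
    then have r: "r < Suc k" unfolding r_def by linarith
    have p: "swap_pair r permutes {..<2 + 2 * k}" using swap_pair_permutes[OF r] by simp
    have im: "swap_pair r i < 2 + 2 * k" if "i < 2 + 2 * k" for i
      using permutes_in_image[OF p, of i] that by simp
    have "Transposition.transpose 0 r (i div 2) = Transposition.transpose 0 r (j div 2) \<longleftrightarrow> i div 2 = j div 2" for i j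
      by (metis Transposition.transpose_involutory)
    moreover have nthM: "M ! i = L ! swap_pair r i" if "i < 2 + 2 * k" for i
      using that by (simp add: M_def del: upt_Suc)
    moreover have "length M = 2 * Suc k" by (simp add: M_def)
    ultimately have M: "standard_list \<beta> (Suc k) M"
      using standard_list_nth[OF Suc.prems, of "swap_pair r i" "swap_pair r j" for i j] im
      by (simp add: standard_list_def swap_pair_div odd_swap_pair)
    have nth: "M ! swap_pair r i = L ! i" if "i < 2 + 2 * k" for i
      using nthM[OF im[OF that]] by (simp add: swap_pair_involutive)
    have \<rho>\<sigma>: "swap_pair r \<circ> \<sigma> permutes {..<2 + 2 * k}" by (rule permutes_compose[OF \<sigma> p])
    have \<sigma>im: "\<sigma> i < 2 + 2 * k" if "i < 2 + 2 * k" for i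
      using permutes_in_image[OF \<sigma>, of i] that by simp
    have "sign (swap_pair r \<circ> \<sigma>) = sign \<sigma>"
      using \<sigma> p by (subst sign_compose) (auto simp: sign_swap_pair permutation_permutes)
    moreover have "map (\<lambda>i. L ! \<sigma> i) [2..<2 + 2 * k] = map (\<lambda>i. M ! (swap_pair r \<circ> \<sigma>) i) [2..<2 + 2 * k]"
      by (rule map_cong) (use nth \<sigma>im in auto)
    moreover have "\<beta> (L ! \<sigma> 0) (L ! \<sigma> 1) = \<beta> (M ! swap_pair r (\<sigma> 0)) (M ! swap_pair r (\<sigma> 1))"
      using nth[OF \<sigma>im[of 0]] nth[OF \<sigma>im[of 1]] by simp
    ultimately have "T L \<sigma> = T M (swap_pair r \<circ> \<sigma>)"
      unfolding T_def comp_apply by (simp only:)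
    moreover have "T M (swap_pair r \<circ> \<sigma>) > 0"
      by (rule first[OF M \<rho>\<sigma>]) (use True in \<open>simp_all add: swap_pair_div r_def\<close>)
    ultimately show ?thesis by simp
  qed
  have "(\<Sum>\<sigma> | \<sigma> permutes {..<2 + 2 * k}. T L \<sigma>) > 0"
  proof (rule sum_pos2[of _ id])
    show "finite {\<sigma>. \<sigma> permutes {..<2 + 2 * k}}" by (rule finite_permutations) simp
    show "T L id > 0" using first[OF Suc.prems permutes_id] by simp
  qed (use nonneg permutes_id in auto)
  then show ?case by (simp add: wedge_def T_def two_form_def upt_2 del: upt_Suc)
qed simp

section \<open>Ricci forms of Hermitian Lie algebras\<close>

locale hermitian_lie_algebra =
  fixes br :: "'a::real_vector \<Rightarrow> 'a \<Rightarrow> 'a" and J :: "'a \<Rightarrow> 'a" and g :: "'a \<Rightarrow> 'a \<Rightarrow> real"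
  assumes lie: "lie_algebra br" and herm: "hermitian_structure br J g"
begin

lemma br_bilinear: "bilinear br"
proof -
  have lin: "br (c *\<^sub>R x + d *\<^sub>R y) z = c *\<^sub>R br x z + d *\<^sub>R br y z \<and>
        br z (c *\<^sub>R x + d *\<^sub>R y) = c *\<^sub>R br z x + d *\<^sub>R br z y" for c d x y z
    using lie by (auto simp: lie_algebra_on_def)
  show ?thesis unfolding bilinear_def
    using lin[of 1 _ 1] lin[of _ _ 0 0] by (auto intro!: linearI)
qed

lemma br_self [simp]: "br x x = 0"
  using lie by (auto simp: lie_algebra_on_def)

lemmas br_simps = bilinear_ladd[OF br_bilinear] bilinear_radd[OF br_bilinear]
  bilinear_lmul[OF br_bilinear] bilinear_rmul[OF br_bilinear]
  bilinear_lneg[OF br_bilinear] bilinear_rneg[OF br_bilinear]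
  bilinear_lsub[OF br_bilinear] bilinear_rsub[OF br_bilinear]
  bilinear_lzero[OF br_bilinear] bilinear_rzero[OF br_bilinear]

lemma br_anti: "br x y = - br y x"
proof -
  have "br (x + y) (x + y) = br x y + br y x"
    unfolding br_simps by (simp add: add.commute)
  then show ?thesis by (simp add: eq_neg_iff_add_eq_0)
qed

lemma g_bilinear: "bilinear g" and g_sym: "g x y = g y x" and g_pos: "x \<noteq> 0 \<Longrightarrow> g x x > 0"
  using herm by (auto simp: hermitian_structure_def inner_product_def)

lemmas g_simps = bilinear_ladd[OF g_bilinear] bilinear_radd[OF g_bilinear]
  bilinear_lmul[OF g_bilinear] bilinear_rmul[OF g_bilinear]
  bilinear_lneg[OF g_bilinear] bilinear_rneg[OF g_bilinear]
  bilinear_lsub[OF g_bilinear] bilinear_rsub[OF g_bilinear]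
  bilinear_lzero[OF g_bilinear] bilinear_rzero[OF g_bilinear]

lemma g_linear_left: "linear (\<lambda>x. g x y)" and g_linear_right: "linear (g x)"
  using g_bilinear by (auto simp: bilinear_def)

lemma g_eqI: assumes "\<And>z. g x z = g y z" shows "x = y"
proof (rule ccontr)
  assume "x \<noteq> y"
  then have "g (x - y) (x - y) > 0" by (intro g_pos) simp
  then show False using assms[of "x - y"] by (simp add: g_simps)
qed

lemma J_linear: "linear J" and J_J [simp]: "J (J x) = - x" and g_J_J [simp]: "g (J x) (J y) = g x y"
  using herm by (auto simp: hermitian_structure_def complex_structure_def)

lemmas J_simps = linear_add[OF J_linear] linear_diff[OF J_linear] linear_neg[OF J_linear]
  linear_scale[OF J_linear] linear_0[OF J_linear]

lemma g_J_left: "g (J x) y = - g x (J y)"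
  using g_J_J[of x "J y"] by (simp add: g_simps)

lemma bilinear_two_form: "bilinear (\<lambda>x y. g (J x) y)"
  unfolding bilinear_def using linear_compose[OF J_linear g_linear_left] g_linear_right
  by (auto simp: o_def)

text \<open>Integrability tested against \<open>w\<close>, with the outer \<open>J\<close> moved
  over to \<open>w\<close>, ready for comparison with \<open>connection_form\<close>.\<close>

lemma nijenhuis:
  "g (br (J x) (J y)) w = g (br x y) w - g (br (J x) y) (J w) - g (br x (J y)) (J w)"
proof -
  have "br (J x) (J y) = br x y + J (br (J x) y) + J (br x (J y))"
    using herm by (simp add: hermitian_structure_def complex_structure_def algebra_simps)
  then show ?thesis by (simp add: g_simps g_J_left)
qed

lemma ce_diff_fundamental_form:
  "ce_diff br (fundamental_form J g) [x, y, z]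
     = g (br x y) (J z) + g (br y z) (J x) + g (br z x) (J y)"
proof -
  have "g (J (br x z)) y = g (br z x) (J y)"
    using br_anti[of x z] by (simp add: g_J_left g_simps)
  then show ?thesis
    by (simp add: ce_diff_def fundamental_form_def two_form_def nths_Cons numeral_2_eq_2
        numeral_3_eq_3 g_J_left)
qed

text \<open>Koszul's formula on left-invariant fields, where the derivatives of the constant
  functions \<open>g x y\<close> drop out.\<close>

definition koszul :: "'a \<Rightarrow> 'a \<Rightarrow> 'a \<Rightarrow> real" where
  "koszul x y z = (g (br x y) z - g (br y z) x + g (br z x) y) / 2"

lemma koszul_simps:
  "koszul (x + x') y z = koszul x y z + koszul x' y z"
  "koszul x (y + y') z = koszul x y z + koszul x y' z"
  "koszul x y (z + z') = koszul x y z + koszul x y z'"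
  "koszul (c *\<^sub>R x) y z = c * koszul x y z"
  "koszul x (c *\<^sub>R y) z = c * koszul x y z"
  "koszul x y (c *\<^sub>R z) = c * koszul x y z"
  by (simp_all add: koszul_def br_simps g_simps field_simps)

section \<open>Orthonormal families: expansion, coordinates and traces\<close>

lemma orthonormal_expansion:
  assumes I: "finite I" and o: "\<And>i j. i \<in> I \<Longrightarrow> j \<in> I \<Longrightarrow> g (e i) (e j) = (if i = j then 1 else 0)"
    and x: "x \<in> span (e ` I)"
  shows "x = (\<Sum>i\<in>I. g x (e i) *\<^sub>R e i)"
proof -
  have lin: "linear (\<lambda>x. \<Sum>i\<in>I. g x (e i) *\<^sub>R e i)"
    by (rule linearI) (simp_all add: g_simps algebra_simps sum.distrib scaleR_sum_right)
  have "(\<lambda>x. x) x = (\<lambda>x. \<Sum>i\<in>I. g x (e i) *\<^sub>R e i) x"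
  proof (rule linear_eq_on_span[OF linear_ident lin _ x])
    fix y assume "y \<in> e ` I"
    then obtain j where j: "j \<in> I" "y = e j" by auto
    have "(\<Sum>i\<in>I. g (e j) (e i) *\<^sub>R e i) = (\<Sum>i\<in>I. if i = j then e i else 0)"
      by (rule sum.cong) (use o j in auto)
    then show "y = (\<Sum>i\<in>I. g y (e i) *\<^sub>R e i)" using j I by simp
  qed
  then show ?thesis by simp
qed

lemma orthonormal_inj:
  assumes o: "\<And>i j. i \<in> I \<Longrightarrow> j \<in> I \<Longrightarrow> g (e i) (e j) = (if i = j then 1 else 0)"
  shows "inj_on e I"
proof (rule inj_onI)
  fix i j assume "i \<in> I" "j \<in> I" "e i = e j"
  then show "i = j" using o[of i j] o[of i i] by (auto split: if_splits)
qed

lemma orthonormal_independent: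
  assumes I: "finite I" and o: "\<And>i j. i \<in> I \<Longrightarrow> j \<in> I \<Longrightarrow> g (e i) (e j) = (if i = j then 1 else 0)"
  shows "independent (e ` I)"
proof (rule independent_if_scalars_zero)
  fix f x assume s: "(\<Sum>x\<in>e ` I. f x *\<^sub>R x) = 0" and "x \<in> e ` I"
  then obtain j where j: "j \<in> I" "x = e j" by auto
  have "0 = g (\<Sum>i\<in>I. f (e i) *\<^sub>R e i) (e j)"
    using s by (simp add: sum.reindex[OF orthonormal_inj[OF o]] g_simps)
  also have "\<dots> = (\<Sum>i\<in>I. if i = j then f (e i) else 0)"
    unfolding linear_sum[OF g_linear_left] by (rule sum.cong) (use o j in \<open>auto simp: g_simps\<close>)
  also have "\<dots> = f x" using j I by simp
  finally show "f x = 0" by simp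
qed (use I in simp)

lemma representation_orthonormal:
  assumes I: "finite I" and o: "\<And>i j. i \<in> I \<Longrightarrow> j \<in> I \<Longrightarrow> g (e i) (e j) = (if i = j then 1 else 0)"
    and x: "x \<in> span (e ` I)" and i: "i \<in> I"
  shows "representation (e ` I) x (e i) = g x (e i)"
proof -
  let ?r = "representation (e ` I) x"
  have "x = (\<Sum>b\<in>e ` I. ?r b *\<^sub>R b)"
    using sum_representation_eq[OF orthonormal_independent[OF I o] x, of "e ` I"] I by simp
  also have "\<dots> = (\<Sum>j\<in>I. ?r (e j) *\<^sub>R e j)"
    by (simp add: sum.reindex[OF orthonormal_inj[OF o]])
  finally have "g x (e i) = g (\<Sum>j\<in>I. ?r (e j) *\<^sub>R e j) (e i)"
    by (rule arg_cong)
  also have "\<dots> = (\<Sum>j\<in>I. ?r (e j) * g (e j) (e i))"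
    by (simp add: linear_sum[OF g_linear_left] g_simps)
  also have "\<dots> = (\<Sum>j\<in>I. if j = i then ?r (e j) else 0)"
    by (rule sum.cong) (use o i in auto)
  finally show ?thesis using I i by simp
qed

text \<open>The map \<open>f\<close> is known only on \<open>V\<close>, as is the \<open>A\<close>
  of the algebraic data, so a linear \<open>F\<close> agreeing with it there is used in its place.
  Expanding between the chosen basis and the orthonormal one in both directions makes the choice
  disappear.\<close>

lemma trace_on_orthonormal:
  assumes I: "finite I" and o: "\<And>i j. i \<in> I \<Longrightarrow> j \<in> I \<Longrightarrow> g (e i) (e j) = (if i = j then 1 else 0)"
    and V: "V = span (e ` I)" and F: "linear F" and FV: "\<And>x. x \<in> V \<Longrightarrow> F x \<in> V"
    and f: "\<And>x. x \<in> V \<Longrightarrow> f x = F x"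
  shows "trace_on V f = (\<Sum>i\<in>I. g (F (e i)) (e i))"
proof -
  define B where "B = (SOME B. independent B \<and> span B = V)"
  have "\<exists>B. independent B \<and> span B = V"
    using orthonormal_independent[OF I o] V by blast
  then have B: "independent B" "span B = V"
    unfolding B_def by (metis (mono_tags, lifting) someI_ex)+
  have fin: "finite B"
    using independent_span_bound[of "e ` I" B] B I span_superset[of B] by (auto simp: V)
  have eV: "e i \<in> V" if "i \<in> I" for i using that by (auto simp: V intro: span_base)
  have bV: "b \<in> V" if "b \<in> B" for b using that B span_base by blast
  have exp: "x = (\<Sum>i\<in>I. g x (e i) *\<^sub>R e i)" if "x \<in> V" for x
    using orthonormal_expansion[OF I o] that V by blast
  have "trace_on V f = (\<Sum>b\<in>B. representation B (F b) b)"
    unfolding trace_on_def Let_def B_def[symmetric] by (rule sum.cong) (use f bV in auto)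
  also have "\<dots> = (\<Sum>b\<in>B. \<Sum>i\<in>I. g (F b) (e i) * representation B (e i) b)"
  proof (rule sum.cong[OF refl])
    fix b assume "b \<in> B"
    then have "representation B (F b) = representation B (\<Sum>i\<in>I. g (F b) (e i) *\<^sub>R e i)"
      using exp[OF FV[OF bV]] by simp
    also have "\<dots> = (\<lambda>b'. \<Sum>i\<in>I. representation B (g (F b) (e i) *\<^sub>R e i) b')"
      by (rule representation_sum[OF B(1)]) (use eV B(2) in \<open>auto intro: span_scale\<close>)
    finally show "representation B (F b) b = (\<Sum>i\<in>I. g (F b) (e i) * representation B (e i) b)"
      using eV B by (simp add: representation_scale)
  qed
  also have "\<dots> = (\<Sum>i\<in>I. \<Sum>b\<in>B. g (F b) (e i) * representation B (e i) b)"
    by (rule sum.swap)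
  also have "\<dots> = (\<Sum>i\<in>I. g (F (e i)) (e i))"
  proof (rule sum.cong[OF refl])
    fix i assume "i \<in> I"
    then have "e i = (\<Sum>b\<in>B. representation B (e i) b *\<^sub>R b)"
      using sum_representation_eq[OF B(1), of "e i" B] fin eV B by simp
    then have "F (e i) = (\<Sum>b\<in>B. representation B (e i) b *\<^sub>R F b)"
      by (metis (no_types, lifting) linear_sum[OF F] linear_scale[OF F] sum.cong)
    then show "(\<Sum>b\<in>B. g (F b) (e i) * representation B (e i) b) = g (F (e i)) (e i)"
      by (simp add: linear_sum[OF g_linear_left] g_simps mult.commute)
  qed
  finally show ?thesis .
qed

end

section \<open>Canonical connections and their Ricci forms in an orthonormal basis\<close>

locale hermitian_lie_algebra_basis = hermitian_lie_algebra +
  fixes m :: nat and e :: "nat \<Rightarrow> 'a"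
  assumes dim_UNIV: "dim (UNIV :: 'a set) = m" and onb: "orthonormal_basis g e"
begin

lemma e_ortho: "i \<in> {1..m} \<Longrightarrow> j \<in> {1..m} \<Longrightarrow> g (e i) (e j) = (if i = j then 1 else 0)"
  and span_e: "span (e ` {1..m}) = UNIV"
  using onb by (auto simp: orthonormal_basis_def dim_UNIV)

lemma basis_expansion: "x = (\<Sum>i\<in>{1..m}. g x (e i) *\<^sub>R e i)"
  by (rule orthonormal_expansion) (use e_ortho in \<open>simp_all only: span_e UNIV_I finite_atLeastAtMost\<close>)

lemma linear_basis: "linear f \<Longrightarrow> f x = (\<Sum>i\<in>{1..m}. g x (e i) *\<^sub>R f (e i))"
  by (subst basis_expansion[of x]) (simp add: linear_sum linear_scale)

lemma g_basis: "g x y = (\<Sum>i\<in>{1..m}. g x (e i) * g y (e i))"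
  using linear_basis[OF g_linear_left, of x y] by (simp add: g_sym[of y])

lemma riesz: "linear \<phi> \<Longrightarrow> g (\<Sum>i\<in>{1..m}. \<phi> (e i) *\<^sub>R e i) z = \<phi> z"
  using linear_basis[of \<phi> z]
  by (simp add: linear_sum[OF g_linear_left] g_simps g_sym[of z] mult.commute)

text \<open>The Riesz vectors of the Koszul expression form a connection with the required
  properties; conversely, skewness with respect to \<open>g\<close> and vanishing torsion determine
  every product \<open>g (D' x y) z\<close>. This resolves the description by
  \<open>THE\<close>.\<close>

lemma g_levi_civita: "g (levi_civita br g x y) z = koszul x y z"
proof -
  define D where "D x y = (\<Sum>i\<in>{1..m}. koszul x y (e i) *\<^sub>R e i)" for x y
  have D: "g (D x y) z = koszul x y z" for x y z
    unfolding D_def by (rule riesz) (auto intro!: linearI simp: koszul_simps)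
  have "levi_civita br g = D" unfolding levi_civita_def
  proof (rule the_equality)
    have "bilinear D" unfolding bilinear_def
      by (intro conjI allI linearI g_eqI) (simp_all add: g_simps D koszul_simps)
    moreover have "g (D x y) z + g y (D x z) = 0" for x y z
      using br_anti[of x y] br_anti[of x z] br_anti[of y z]
      by (simp add: g_sym[of y] D koszul_def g_simps field_simps)
    moreover have "D x y - D y x = br x y" for x y
    proof (rule g_eqI)
      fix z show "g (D x y - D y x) z = g (br x y) z"
        using br_anti[of x y] br_anti[of x z] br_anti[of y z]
        by (simp add: g_simps D koszul_def field_simps)
    qed
    ultimately show "bilinear D \<and> (\<forall>x y z. g (D x y) z + g y (D x z) = 0) \<and>
        (\<forall>x y. D x y - D y x = br x y)" by blast
  next
    fix D' assume *: "bilinear D' \<and> (\<forall>x y z. g (D' x y) z + g y (D' x z) = 0) \<and>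
        (\<forall>x y. D' x y - D' y x = br x y)"
    have "g (D' x y) z = koszul x y z" for x y z
    proof -
      have m: "g (D' x y) z = - g (D' x z) y" for x y z
        using * g_sym by (metis eq_neg_iff_add_eq_0)
      have t: "g (br x y) z = g (D' x y) z - g (D' y x) z" for x y z
        using * by (metis bilinear_lsub[OF g_bilinear])
      show ?thesis unfolding koszul_def t
        using m[of x y z] m[of y x z] m[of z x y] by simp
    qed
    then show "D' = D" by (intro ext g_eqI) (simp add: D)
  qed
  then show ?thesis by (simp add: D)
qed

text \<open>The canonical connection paired with \<open>z\<close>, with the differential of the
  fundamental form expanded. The minus signs come from \<open>J (J z) = - z\<close> in
  \<open>T\<close> and from the sign in the definition of \<open>C\<close>.\<close>

definition connection_form :: "real \<Rightarrow> 'a \<Rightarrow> 'a \<Rightarrow> 'a \<Rightarrow> real" where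
  "connection_form \<tau> x y z = koszul x y z
     - (1 - \<tau>) / 4 * (g (br (J x) (J y)) z + g (br (J y) (J z)) x + g (br (J z) (J x)) y)
     - (1 + \<tau>) / 4 * (g (br (J x) y) (J z) - g (br y z) x + g (br z (J x)) (J y))"

lemma connection_form_simps:
  "connection_form \<tau> (x + x') y z = connection_form \<tau> x y z + connection_form \<tau> x' y z"
  "connection_form \<tau> x (y + y') z = connection_form \<tau> x y z + connection_form \<tau> x y' z"
  "connection_form \<tau> x y (z + z') = connection_form \<tau> x y z + connection_form \<tau> x y z'"
  "connection_form \<tau> (c *\<^sub>R x) y z = c * connection_form \<tau> x y z"
  "connection_form \<tau> x (c *\<^sub>R y) z = c * connection_form \<tau> x y z"
  "connection_form \<tau> x y (c *\<^sub>R z) = c * connection_form \<tau> x y z"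
  by (simp_all only: connection_form_def koszul_simps br_simps g_simps J_simps)
     (simp_all add: algebra_simps)

lemma g_canonical_connection:
  "g (canonical_connection br J g \<tau> x y) z = connection_form \<tau> x y z"
proof -
  have *: "g (levi_civita br g x y) z + (1 - \<tau>) / 4 * ce_diff br (fundamental_form J g) [J x, J y, J z]
       + (1 + \<tau>) / 4 * - ce_diff br (fundamental_form J g) [J x, y, z] = connection_form \<tau> x y z" for z
    by (simp add: g_levi_civita ce_diff_fundamental_form connection_form_def g_simps)
       (simp add: field_simps)
  let ?W = "\<Sum>i\<in>{1..m}. connection_form \<tau> x y (e i) *\<^sub>R e i"
  have W: "g ?W z = connection_form \<tau> x y z" for z
    by (rule riesz) (auto intro!: linearI simp: connection_form_simps)
  have "canonical_connection br J g \<tau> x y = ?W"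
    unfolding canonical_connection_def Let_def *
    by (rule the_equality) (use W in \<open>auto intro!: g_eqI\<close>)
  then show ?thesis using W by (simp only:)
qed

lemma connection_form_metric: "connection_form \<tau> x y z = - connection_form \<tau> x z y"
  using br_anti[of x y] br_anti[of x z] br_anti[of y z] br_anti[of "J x" "J y"]
    br_anti[of "J x" "J z"] br_anti[of "J y" "J z"] br_anti[of "J x" y] br_anti[of "J x" z]
  by (simp add: connection_form_def koszul_def g_simps) (simp add: field_simps)

text \<open>Replacing \<open>y\<close>, \<open>z\<close> by \<open>J y\<close>, \<open>J z\<close>
  turns \<open>T\<close> into \<open>- C\<close> and \<open>C\<close> into \<open>- T\<close>. The
  coefficients \<open>(1 - \<tau>) / 4\<close> and \<open>(1 + \<tau>) / 4\<close> therefore add up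
  to 1/2 and \<open>\<tau>\<close> disappears; what is left cancels by integrability for the pairs
  \<open>x, y\<close> and \<open>z, x\<close>.\<close>

lemma connection_form_J: "connection_form \<tau> x (J y) (J z) = connection_form \<tau> x y z"
proof -
  have "connection_form \<tau> x (J y) (J z) - connection_form \<tau> x y z =
      (g (br x (J y)) (J z) + g (br (J x) y) (J z) + g (br (J x) (J y)) z - g (br x y) z
      + g (br (J z) x) (J y) + g (br z (J x)) (J y) + g (br (J z) (J x)) y - g (br z x) y) / 2"
    by (simp add: connection_form_def koszul_def g_simps br_simps) (simp add: field_simps)
  also have "\<dots> = 0"
    unfolding nijenhuis[of x y z] nijenhuis[of z x y] by simp
  finally show ?thesis by simp
qed

end

text \<open>Each \<open>f i\<close> is expanded in \<open>e\<close>, and then each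
  \<open>e j\<close> is recovered from its coordinates along \<open>f\<close>. Outside the locale
  the statement can speak of two orthonormal bases at once.\<close>

lemma sum_diagonal_orthonormal:
  fixes h :: "'a::real_vector \<Rightarrow> 'a \<Rightarrow> real"
  assumes E: "hermitian_lie_algebra_basis br J g m e" and F: "orthonormal_basis g f" and h: "bilinear h"
  shows "(\<Sum>i=1..m. h (f i) (f i)) = (\<Sum>i=1..m. h (e i) (e i))"
proof -
  interpret E: hermitian_lie_algebra_basis br J g m e by (rule E)
  interpret F: hermitian_lie_algebra_basis br J g m f
    using F E.dim_UNIV by unfold_locales
  have l: "linear (\<lambda>x. h x y)" and r: "linear (h y)" for y using h by (auto simp: bilinear_def)
  have lb: "h x y = (\<Sum>j\<in>{1..m}. g x (e j) * h (e j) y)" for x y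
    using E.linear_basis[OF l, of x y] by simp
  have rb: "h y x = (\<Sum>j\<in>{1..m}. g x (f j) * h y (f j))" for x y
    using F.linear_basis[OF r, of y x] by simp
  have "(\<Sum>i\<in>{1..m}. h (f i) (f i)) = (\<Sum>i\<in>{1..m}. \<Sum>j\<in>{1..m}. g (f i) (e j) * h (e j) (f i))"
    by (intro sum.cong refl lb)
  also have "\<dots> = (\<Sum>j\<in>{1..m}. \<Sum>i\<in>{1..m}. g (e j) (f i) * h (e j) (f i))"
    by (subst sum.swap) (simp add: E.g_sym)
  also have "\<dots> = (\<Sum>j\<in>{1..m}. h (e j) (e j))"
    by (intro sum.cong refl rb[symmetric])
  finally show ?thesis .
qed

context hermitian_lie_algebra_basis
begin

lemma orthonormal_basis_J: "orthonormal_basis g (J \<circ> e)"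
  unfolding orthonormal_basis_def dim_UNIV
proof
  have "span ((J \<circ> e) ` {1..m}) = J ` span (e ` {1..m})"
    unfolding image_comp[symmetric] by (rule linear_span_image[OF J_linear])
  also have "\<dots> = UNIV"
    unfolding span_e by (rule surjI[of _ "\<lambda>x. - J x"]) (simp add: J_simps)
  finally show "span ((J \<circ> e) ` {1..m}) = UNIV" .
qed (use e_ortho in auto)

lemma sum_diagonal_J:
  "bilinear h \<Longrightarrow> (\<Sum>i\<in>{1..m}. h (J (e i)) (J (e i))) = (\<Sum>i\<in>{1..m}. h (e i) (e i) :: real)"
  using sum_diagonal_orthonormal[OF hermitian_lie_algebra_basis_axioms orthonormal_basis_J] by simp

abbreviation "tr_ad x \<equiv> \<Sum>i\<in>{1..m}. g (br x (e i)) (e i)"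

text \<open>The trace of \<open>J [\<nabla>\<^sub>X, \<nabla>\<^sub>Y]\<close> vanishes because both operators commute with \<open>J\<close>, so only the
  \<open>\<nabla>\<^bsub>[X,Y]\<^esub>\<close> term of the curvature survives.\<close>

lemma ricci_form_connection_form:
  "ricci_form br J g \<tau> e x y = (\<Sum>i\<in>{1..m}. connection_form \<tau> (br x y) (e i) (J (e i))) / 2"
proof -
  let ?D = "canonical_connection br J g \<tau>"
  have metric: "g (?D x y) z = - g y (?D x z)" for x y z
    using connection_form_metric[of \<tau> x y z] by (simp add: g_canonical_connection g_sym[of y])
  have DJ: "?D x (J y) = J (?D x y)" for x y
  proof (rule g_eqI)
    fix z show "g (?D x (J y)) z = g (J (?D x y)) z"
      using connection_form_J[of \<tau> x y "J z"] connection_form_simps(6)[of \<tau> x "J y" "-1" z]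
      by (simp add: g_canonical_connection g_J_left)
  qed
  have comm: "(\<Sum>i\<in>{1..m}. g (?D x (?D y (e i))) (J (e i))) = (\<Sum>i\<in>{1..m}. g (?D y (?D x (e i))) (J (e i)))" for x y
  proof -
    have 1: "g (?D x (?D y u)) (J u) = - g (?D y u) (J (?D x u))" for x y u
      by (simp only: metric[of x "?D y u"] DJ)
    \<comment> \<open>The matrix of \<open>?D y\<close> is skew. That of \<open>J\<close> after
      \<open>?D x\<close> is symmetric, because both factors are skew and commute. The trace of a
      skew times a symmetric matrix is zero.\<close>
    have *: "g (?D y (e i)) (e k) * g (J (?D x (e i))) (e k)
        = - (g (?D y (e k)) (e i) * g (J (?D x (e k))) (e i))" for i k
    proof -
      have "g (?D y (e i)) (e k) = - g (?D y (e k)) (e i)"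
        using metric g_sym by metis
      moreover have "g (J (?D x (e i))) (e k) = g (J (?D x (e k))) (e i)"
        using metric[of x "e i" "J (e k)"] g_sym[of "e i"] by (simp add: g_J_left DJ)
      ultimately show ?thesis by simp
    qed
    have "(\<Sum>i\<in>{1..m}. g (?D y (e i)) (J (?D x (e i))))
        = (\<Sum>i\<in>{1..m}. \<Sum>k\<in>{1..m}. g (?D y (e i)) (e k) * g (J (?D x (e i))) (e k))"
      by (subst g_basis) simp
    also have "\<dots> = - (\<Sum>i\<in>{1..m}. \<Sum>k\<in>{1..m}. g (?D y (e k)) (e i) * g (J (?D x (e k))) (e i))"
      unfolding sum_negf[symmetric] by (intro sum.cong refl *)
    also have "\<dots> = - (\<Sum>k\<in>{1..m}. \<Sum>i\<in>{1..m}. g (?D y (e k)) (e i) * g (J (?D x (e k))) (e i))"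
      by (subst sum.swap) simp
    also have "\<dots> = - (\<Sum>i\<in>{1..m}. g (?D y (e i)) (J (?D x (e i))))"
      by (subst (2) g_basis) simp
    finally have z: "(\<Sum>i\<in>{1..m}. g (?D y (e i)) (J (?D x (e i)))) = 0" by simp
    have "(\<Sum>i\<in>{1..m}. g (?D x (e i)) (J (?D y (e i)))) = - (\<Sum>i\<in>{1..m}. g (?D y (e i)) (J (?D x (e i))))"
      by (simp add: sum_negf[symmetric] g_J_left[symmetric]) (simp add: g_sym)
    with z show ?thesis by (simp add: 1 sum_negf)
  qed
  have "g (curvature br ?D x y u) (J u) = g (?D x (?D y u)) (J u) - g (?D y (?D x u)) (J u)
      - connection_form \<tau> (br x y) u (J u)" for u
    by (simp add: curvature_def g_simps g_canonical_connection)
  then show ?thesis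
    using comm[of x y] by (simp add: ricci_form_def dim_UNIV sum_subtractf)
qed

lemma sum_br_J_swap:
  "(\<Sum>i\<in>{1..m}. g (br (J (e i)) w) (e i)) = (\<Sum>i\<in>{1..m}. g (br w (e i)) (J (e i)))"
proof -
  have "bilinear (\<lambda>x y. g (br w x) (J y))"
    unfolding bilinear_def by (auto intro!: linearI simp: br_simps g_simps J_simps)
  from sum_diagonal_J[OF this]
  have "(\<Sum>i\<in>{1..m}. g (br w (J (e i))) (- e i)) = (\<Sum>i\<in>{1..m}. g (br w (e i)) (J (e i)))" by simp
  moreover have "g (br (J u) w) u = g (br w (J u)) (- u)" for u
    by (subst br_anti) (simp add: g_simps)
  ultimately show ?thesis by simp
qed

lemma tr_ad_J: "(\<Sum>i\<in>{1..m}. g (br w (J (e i))) (J (e i))) = tr_ad w"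
proof -
  have "bilinear (\<lambda>x y. g (br w x) y)"
    unfolding bilinear_def by (auto intro!: linearI simp: br_simps g_simps)
  from sum_diagonal_J[OF this] show ?thesis .
qed

text \<open>For \<open>\<tau> = 1\<close> only \<open>C\<close> contributes. Traces over
  \<open>J \<circ> e\<close> and over \<open>e\<close> agree, so each of the two resulting sums
  occurs twice.\<close>

lemma chern_ricci_form_eq:
  "chern_ricci_form br J g e x y
     = ((\<Sum>i\<in>{1..m}. g (br (br x y) (e i)) (J (e i))) + tr_ad (J (br x y))) / 2"
proof -
  have *: "connection_form 1 w u (J u) = (g (br w u) (J u) + g (br (J u) w) u
      + g (br (J w) u) u + g (br (J w) (J u)) (J u)) / 2" for w u
    using br_anti[of "J u" "J w"]
    by (simp add: connection_form_def koszul_def g_simps) (simp add: field_simps)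
  show ?thesis
    unfolding ricci_form_connection_form * sum_divide_distrib[symmetric] sum.distrib
      sum_br_J_swap tr_ad_J by simp
qed

text \<open>For \<open>\<tau> = -1\<close> only \<open>T\<close> contributes. The term
  \<open>g (br u (J u)) w\<close> is met once in the Koszul part and once in the torsion part, hence
  its factor 2.\<close>

lemma bismut_ricci_form_eq:
  "bismut_ricci_form br J g e x y
     = ((\<Sum>i\<in>{1..m}. g (br (br x y) (e i)) (J (e i)))
        - (\<Sum>i\<in>{1..m}. g (br (e i) (J (e i))) (br x y)) - tr_ad (J (br x y))) / 2"
proof -
  have *: "connection_form (-1) w u (J u) = (g (br w u) (J u) + g (br (J u) w) u
      - 2 * g (br u (J u)) w - g (br (J w) u) u - g (br (J w) (J u)) (J u)) / 2" for w u
    using br_anti[of "J u" u] br_anti[of u "J w"]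
    by (simp add: connection_form_def koszul_def g_simps br_simps) (simp add: field_simps)
  show ?thesis
    unfolding ricci_form_connection_form * sum_divide_distrib[symmetric] sum.distrib
      sum_subtractf sum_distrib_left[symmetric] sum_br_J_swap tr_ad_J by simp
qed

text \<open>By \<open>ricci_form_connection_form\<close> the Ricci form is a diagonal sum of a
  bilinear form. Results found in an adapted basis thus carry over to any orthonormal one.\<close>

lemma ricci_form_basis_independent:
  assumes f: "orthonormal_basis g f"
  shows "ricci_form br J g \<tau> f x y = ricci_form br J g \<tau> e x y"
proof -
  interpret F: hermitian_lie_algebra_basis br J g m f using f dim_UNIV by unfold_locales
  have "bilinear (\<lambda>u w. connection_form \<tau> (br x y) u (J w))"
    unfolding bilinear_def by (auto intro!: linearI simp: J_simps connection_form_simps)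
  from sum_diagonal_orthonormal[OF hermitian_lie_algebra_basis_axioms f this]
  show ?thesis
    by (simp add: ricci_form_connection_form F.ricci_form_connection_form)
qed

end

section \<open>Almost abelian Lie algebras\<close>

text \<open>The condition on \<open>0 # Z\<close> takes the place of linearity, so that a contracted
  form \<open>insert_second y \<alpha>\<close> can be treated as well.\<close>

lemma ce_diff_abelian:
  assumes "\<And>x y. x \<in> set Y \<Longrightarrow> y \<in> set Y \<Longrightarrow> br x y = 0"
    and "\<And>Z. length Z + 2 = length Y \<Longrightarrow> set Z \<subseteq> set Y \<Longrightarrow> \<beta> (0 # Z) = 0"
  shows "ce_diff br \<beta> Y = 0"
  unfolding ce_diff_def
proof (intro sum.neutral ballI)
  fix j i assume "j \<in> {..<length Y}" "i \<in> {..<j}"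
  then have *: "i < j" "j < length Y" by auto
  then have "br (Y ! i) (Y ! j) = 0" by (intro assms(1)) auto
  moreover have "\<beta> (0 # nths Y (- {i, j})) = 0"
    using length_nths_omit2[OF *] set_nths_subset by (intro assms(2))
  ultimately show "(- 1) ^ (i + j) * \<beta> (br (Y ! i) (Y ! j) # nths Y (- {i, j})) = 0" by simp
qed

locale hermitian_almost_abelian = hermitian_lie_algebra_basis br J g "2 * n" e
  for br :: "'a::real_vector \<Rightarrow> 'a \<Rightarrow> 'a" and J g n e +
  fixes N :: "'a set" and a :: real and v :: 'a and A :: "'a \<Rightarrow> 'a"
  assumes ideal: "codim_one_abelian_ideal br N" and adapted: "adapted_unitary_basis J g N n e"
    and data: "algebraic_data br J N n e a v A"
begin

declare One_nat_def [simp del]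

abbreviation "D \<equiv> br (e (2 * n))"

section \<open>Coordinates, brackets and traces in an adapted basis\<close>

lemma n_pos: "n \<ge> 1"
  using ideal adapted
  by (cases n) (auto simp: codim_one_abelian_ideal_def adapted_unitary_basis_def)

lemma J_e: "1 \<le> i \<Longrightarrow> i \<le> n \<Longrightarrow> J (e i) = e (2 * n + 1 - i)"
  using adapted by (auto simp: adapted_unitary_basis_def)

lemma J_e': "n < i \<Longrightarrow> i \<le> 2 * n \<Longrightarrow> J (e i) = - e (2 * n + 1 - i)"
  using J_e[of "2 * n + 1 - i"] J_J[of "e (2 * n + 1 - i)"] by simp

lemma J_e_first: "J (e 1) = e (2 * n)" and J_e_last: "J (e (2 * n)) = - e 1"
  using J_e[of 1] J_e'[of "2 * n"] n_pos by auto

lemma e_orth: "1 \<le> i \<Longrightarrow> i \<le> 2 * n \<Longrightarrow> 1 \<le> j \<Longrightarrow> j \<le> 2 * n \<Longrightarrow> g (e i) (e j) = (if i = j then 1 else 0)"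
  using e_ortho[of i j] by auto

lemma subspace_N: "subspace N" and N_abelian: "x \<in> N \<Longrightarrow> y \<in> N \<Longrightarrow> br x y = 0"
  and N_ideal: "y \<in> N \<Longrightarrow> br x y \<in> N"
  using ideal by (auto simp: codim_one_abelian_ideal_def abelian_ideal_def)

lemma N_span: "N = span (e ` {1..2 * n - 1})" and N1_span: "N \<inter> J ` N = span (e ` {2..2 * n - 1})"
  using adapted by (auto simp: adapted_unitary_basis_def)

lemma N_iff: "x \<in> N \<longleftrightarrow> g x (e (2 * n)) = 0"
proof
  assume "x \<in> N"
  then show "g x (e (2 * n)) = 0"
    unfolding N_span
    by (rule linear_eq_0_on_span[OF g_linear_left, rotated]) (use n_pos e_orth in auto)
next
  assume 0: "g x (e (2 * n)) = 0"
  have "{1..2 * n} = insert (2 * n) {1..2 * n - 1}" using n_pos by auto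
  then have "x = (\<Sum>i\<in>{1..2 * n - 1}. g x (e i) *\<^sub>R e i)"
    using basis_expansion[of x] 0 n_pos by simp
  also have "\<dots> \<in> N"
    unfolding N_span by (intro span_sum span_scale span_base) auto
  finally show "x \<in> N" .
qed

lemma N1_iff: "x \<in> N \<inter> J ` N \<longleftrightarrow> g x (e 1) = 0 \<and> g x (e (2 * n)) = 0"
proof -
  have "x \<in> J ` N \<longleftrightarrow> J x \<in> N"
  proof
    assume "J x \<in> N"
    then have "- J x \<in> N" using subspace_neg[OF subspace_N] by blast
    then show "x \<in> J ` N" by (rule image_eqI[rotated]) (simp add: J_simps)
  qed (use subspace_neg[OF subspace_N] in auto)
  moreover have "g (J x) (e (2 * n)) = g x (e 1)"
    unfolding J_e_first[symmetric] by simp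
  ultimately show ?thesis by (auto simp: N_iff)
qed

lemma e_N: "1 \<le> i \<Longrightarrow> i < 2 * n \<Longrightarrow> e i \<in> N"
  by (simp add: N_iff e_orth)

lemma e_N1: "2 \<le> i \<Longrightarrow> i < 2 * n \<Longrightarrow> e i \<in> N \<inter> J ` N"
  unfolding N1_iff by (simp add: e_orth)

text \<open>The projections \<open>?p x\<close> and \<open>?p y\<close> lie in the abelian ideal, so
  their bracket is zero; expanding it gives the formula.\<close>

lemma D_N: "D x \<in> N" and br_eq: "br x y = g x (e (2 * n)) *\<^sub>R D y - g y (e (2 * n)) *\<^sub>R D x"
proof -
  let ?p = "\<lambda>x. x - g x (e (2 * n)) *\<^sub>R e (2 * n)"
  have p: "?p x \<in> N" for x using n_pos by (simp add: N_iff g_simps e_orth)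
  have "br (?p x) (?p y) = br x y - g x (e (2 * n)) *\<^sub>R D y + g y (e (2 * n)) *\<^sub>R D x"
    unfolding br_simps br_anti[of x "e (2 * n)"] by simp
  moreover have "br (?p x) (?p y) = 0" by (rule N_abelian[OF p p])
  ultimately show "br x y = g x (e (2 * n)) *\<^sub>R D y - g y (e (2 * n)) *\<^sub>R D x"
    by (simp add: algebra_simps)
  have "D (?p x) \<in> N" by (rule N_ideal[OF p])
  then show "D x \<in> N" by (simp add: br_simps)
qed

lemma br_N: "br x y \<in> N"
  unfolding br_eq[of x y] by (intro subspace_diff[OF subspace_N] subspace_scale[OF subspace_N] D_N)

lemma v_N1: "v \<in> N \<inter> J ` N" and D_e1: "D (e 1) = a *\<^sub>R e 1 + v"
  and D_N1_eq: "x \<in> N \<inter> J ` N \<Longrightarrow> D x = A x"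
  using data by (auto simp: algebraic_data_def)

lemma D_N1: "x \<in> N \<inter> J ` N \<Longrightarrow> D x \<in> N \<inter> J ` N"
  using algebraic_data_endomorphism(1)[OF lie herm ideal adapted data] D_N1_eq by simp

lemma g_v: "g v (e 1) = 0" "g v (e (2 * n)) = 0"
  using v_N1 unfolding N1_iff by auto

text \<open>The component of \<open>x\<close> in \<open>N\<^sub>1\<close> stays in
  \<open>N\<^sub>1\<close>, which is orthogonal to \<open>e 1\<close>, as is \<open>v\<close>; and
  \<open>D\<close> kills \<open>e (2 * n)\<close>. Only \<open>a\<close> times the first coordinate
  remains.\<close>

lemma g_D_e1: "g (D x) (e 1) = a * g x (e 1)"
proof -
  let ?y = "x - g x (e 1) *\<^sub>R e 1 - g x (e (2 * n)) *\<^sub>R e (2 * n)"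
  have "?y \<in> N \<inter> J ` N"
    unfolding N1_iff using n_pos by (simp add: g_simps e_orth)
  then have "g (D ?y) (e 1) = 0" using D_N1 N1_iff by blast
  then show ?thesis using n_pos by (simp add: br_simps g_simps D_e1 g_v e_orth)
qed

text \<open>Written with \<open>D\<close>, which is linear on the whole space, whereas
  \<open>A\<close> is prescribed only on \<open>N\<^sub>1\<close>.\<close>

definition trA :: real where "trA = (\<Sum>i\<in>{2..2 * n - 1}. g (D (e i)) (e i))"

lemma trace_on_A: "trace_on (N \<inter> J ` N) A = trA"
  unfolding trA_def
proof (rule trace_on_orthonormal[OF _ _ N1_span])
  show "linear D" using br_bilinear by (simp add: bilinear_def)
qed (use D_N1 D_N1_eq e_orth in auto)

lemma sum_split: "(\<Sum>i\<in>{1..2 * n}. f i) = f 1 + (\<Sum>i\<in>{2..2 * n - 1}. f i) + (f (2 * n) :: real)"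
proof -
  have "{1..2 * n} = insert 1 (insert (2 * n) {2..2 * n - 1})" using n_pos by auto
  moreover have "1 \<noteq> 2 * n" "1 \<notin> {2..2 * n - 1}" "2 * n \<notin> {2..2 * n - 1}" using n_pos by auto
  ultimately show ?thesis by simp
qed

lemma tr_ad_eq: "(\<Sum>i\<in>{1..2 * n}. g (br x (e i)) (e i)) = g x (e (2 * n)) * (a + trA)"
proof -
  have *: "br x (e i) = g x (e (2 * n)) *\<^sub>R D (e i)" if "1 \<le> i" "i < 2 * n" for i
    using that n_pos by (subst br_eq) (simp add: e_orth)
  have "g (br x (e 1)) (e 1) = g x (e (2 * n)) * a"
    using *[of 1] n_pos by (simp add: g_simps g_D_e1 e_orth)
  moreover have "(\<Sum>i\<in>{2..2 * n - 1}. g (br x (e i)) (e i)) = g x (e (2 * n)) * trA"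
    unfolding trA_def sum_distrib_left by (rule sum.cong) (use * in \<open>auto simp: g_simps\<close>)
  moreover have "g (br x (e (2 * n))) (e (2 * n)) = 0" using br_N N_iff by blast
  ultimately show ?thesis unfolding sum_split by (simp add: algebra_simps)
qed

lemma J_e_N: "2 \<le> i \<Longrightarrow> i < 2 * n \<Longrightarrow> J (e i) \<in> N"
  using e_N1[of i] subspace_neg[OF subspace_N] by auto

text \<open>The middle pairs lie in the abelian ideal. The pair \<open>e 1\<close>,
  \<open>e (2 * n)\<close> is met for \<open>i = 1\<close> and for \<open>i = 2 * n\<close>, each
  time with bracket \<open>- (a *\<^sub>R e 1 + v)\<close>.\<close>

lemma sum_br_e_J_e: "(\<Sum>i\<in>{1..2 * n}. g (br (e i) (J (e i))) w) = - 2 * g (a *\<^sub>R e 1 + v) w"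
proof -
  have "br (e i) (J (e i)) = 0" if "i \<in> {2..2 * n - 1}" for i
    using that by (intro N_abelian e_N J_e_N) auto
  then have "(\<Sum>i\<in>{2..2 * n - 1}. g (br (e i) (J (e i))) w) = 0"
    by (simp add: g_simps)
  moreover have "br (e 1) (J (e 1)) = - (a *\<^sub>R e 1 + v)"
    unfolding J_e_first by (subst br_anti) (simp add: D_e1)
  moreover have "br (e (2 * n)) (J (e (2 * n))) = - (a *\<^sub>R e 1 + v)"
    unfolding J_e_last by (simp add: br_simps D_e1)
  ultimately show ?thesis unfolding sum_split by (simp add: g_simps)
qed

lemma sum_br_w_e_J_e:
  assumes "w \<in> N" shows "(\<Sum>i\<in>{1..2 * n}. g (br w (e i)) (J (e i))) = a * g w (e 1)"
proof -
  have *: "br w (e i) = 0" if "1 \<le> i" "i < 2 * n" for i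
    using that assms by (intro N_abelian e_N)
  have "(\<Sum>i\<in>{2..2 * n - 1}. g (br w (e i)) (J (e i))) = 0"
    by (rule sum.neutral) (use * in \<open>auto simp: g_simps\<close>)
  moreover have "br w (e 1) = 0" using *[of 1] n_pos by simp
  moreover have "g (br w (e (2 * n))) (J (e (2 * n))) = a * g w (e 1)"
    unfolding J_e_last by (subst br_anti) (simp add: g_simps g_D_e1)
  ultimately show ?thesis unfolding sum_split by (simp add: g_simps)
qed

lemma tr_ad_J_eq: "(\<Sum>i\<in>{1..2 * n}. g (br (J w) (e i)) (e i)) = g w (e 1) * (a + trA)"
  unfolding tr_ad_eq by (simp add: J_e_first[symmetric])

lemma g_br_e1:
  "g (br x y) (e 1) = a * (g x (e (2 * n)) * g y (e 1) - g y (e (2 * n)) * g x (e 1))"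
  by (subst br_eq) (simp add: g_simps g_D_e1, simp add: algebra_simps)

text \<open>With \<open>c = g (br x y) (e 1)\<close>, the three sums in the Bismut formula are
  \<open>a * c\<close>, \<open>- 2 * a * c\<close> and \<open>a * c\<close>. The Chern form is half
  of \<open>a * c + a * c\<close>, the Bismut form half of
  \<open>a * c + 2 * a * c - a * c\<close>.\<close>

lemma ricci_forms_eq:
  assumes "v = 0" "trA = 0"
  shows "chern_ricci_form br J g e x y = a * g (br x y) (e 1)"
    and "bismut_ricci_form br J g e x y = a * g (br x y) (e 1)"
  unfolding chern_ricci_form_eq bismut_ricci_form_eq sum_br_w_e_J_e[OF br_N] tr_ad_J_eq
    sum_br_e_J_e using assms g_sym[of "e 1"] by (simp_all add: g_simps)

lemma wedge_one_forms:
  "wedge 1 1 (one_form (dual_basis n e 1)) (one_form (dual_basis n e (2 * n))) [x, y]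
     = g x (e 1) * g y (e (2 * n)) - g y (e 1) * g x (e (2 * n))"
proof -
  have d: "dual_basis n e i x = g x (e i)" if "i \<in> {1..2 * n}" for i x
    unfolding dual_basis_def
    by (rule representation_orthonormal[OF _ e_ortho _ that]) (use span_e in auto)
  have p: "{\<sigma>. \<sigma> permutes {..<2 :: nat}} = {id, Transposition.transpose 0 1}"
  proof -
    have *: "{..<2} = {0, 1 :: nat}" by auto
    show ?thesis unfolding * permutes_doubleton_iff by blast
  qed
  have ne: "id \<noteq> Transposition.transpose 0 (1 :: nat)"
    by (auto simp: fun_eq_iff Transposition.transpose_def)
  show ?thesis
    using d[of 1] d[of "2 * n"] n_pos ne
    by (simp add: wedge_def p one_form_def sign_swap_id)
qed

section \<open>The balanced condition in terms of the algebraic data\<close>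

abbreviation \<omega> :: "'a \<Rightarrow> 'a \<Rightarrow> real" where "\<omega> \<equiv> \<lambda>x y. g (J x) y"

abbreviation \<eta> :: "'a form" where "\<eta> \<equiv> two_form_power (two_form \<omega>) (n - 1)"

lemma balanced_iff: "balanced br J g \<longleftrightarrow> (\<forall>X. length X = 2 * n - 1 \<longrightarrow> ce_diff br \<eta> X = 0)"
  by (simp add: balanced_def dim_UNIV fundamental_form_def Let_def)

lemma \<eta>_multilinear: "multilinear (2 * (n - 1)) \<eta>"
  by (rule multilinear_two_form_power[OF bilinear_two_form])

lemma \<eta>_swap: "swap_antisym (2 * (n - 1)) \<eta>"
  by (rule swap_antisym_two_form_power)

lemma \<eta>_0: "length Z + 1 = 2 * (n - 1) \<Longrightarrow> \<eta> (0 # Z) = 0"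
  using linear_0[OF multilinear_head[OF \<eta>_multilinear]] by blast

lemma \<eta>_radical:
  assumes "c *\<^sub>R e 1 \<in> set Z" "set Z \<subseteq> N" "length Z = 2 * (n - 1)"
  shows "\<eta> Z = 0"
proof (rule two_form_power_radical[OF assms(1,3)])
  fix y assume "y \<in> set Z"
  then have "g y (e (2 * n)) = 0" using assms(2) N_iff by auto
  then show "g (J (c *\<^sub>R e 1)) y = 0 \<and> g (J y) (c *\<^sub>R e 1) = 0"
    using g_J_left[of y "e 1"] g_sym[of "e (2 * n)"]
    by (simp add: J_simps g_simps J_e_first)
qed

lemma ce_diff_\<eta>_N:
  assumes "set X \<subseteq> N" "length X = 2 * n - 1" shows "ce_diff br \<eta> X = 0"
  by (rule ce_diff_abelian) (use assms N_abelian n_pos in \<open>auto intro!: \<eta>_0\<close>)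

lemma ce_diff_\<eta>_Cons:
  assumes "set Y \<subseteq> N" "length Y = 2 * (n - 1)"
  shows "ce_diff br \<eta> (e (2 * n) # Y) = - derivation_sum D \<eta> Y"
proof -
  have "ce_diff br (insert_second (e (2 * n)) \<eta>) Y = 0"
    by (rule ce_diff_abelian) (use assms N_abelian in \<open>auto simp: insert_second_def intro!: \<eta>_0\<close>)
  then show ?thesis by (simp add: ce_diff_Cons)
qed

text \<open>Each summand either acts on \<open>e 1\<close>, which \<open>v = 0\<close> turns into a
  multiple of itself, or leaves \<open>e 1\<close> in the list. Either way the list contains a
  radical vector.\<close>

lemma derivation_sum_radical:
  assumes v: "v = 0" and Y: "e 1 \<in> set Y" "set Y \<subseteq> N" "length Y = 2 * (n - 1)"
  shows "derivation_sum D \<eta> Y = 0"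
  unfolding derivation_sum_def
proof (intro sum.neutral ballI)
  fix j assume "j \<in> {..<length Y}"
  then have j: "j < length Y" by simp
  let ?Z = "D (Y ! j) # nths Y (- {j})"
  have len: "length ?Z = 2 * (n - 1)" using Y(3) j by (simp add: nths_omit)
  have N: "set ?Z \<subseteq> N" using D_N Y(2) set_nths_subset[of Y "- {j}"] by auto
  obtain c where "c *\<^sub>R e 1 \<in> set ?Z"
  proof (cases "Y ! j = e 1")
    case True
    then show ?thesis using that[of a] v D_e1 by simp
  next
    case False
    have "Y = take j Y @ Y ! j # drop (Suc j) Y" by (rule id_take_nth_drop[OF j])
    then have "e 1 \<in> set (take j Y @ Y ! j # drop (Suc j) Y)" using Y(1) by simp
    then show ?thesis using that[of 1] False j by (auto simp: nths_omit)
  qed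
  then show "(- 1) ^ j * \<eta> ?Z = 0" using \<eta>_radical[OF _ N len] by simp
qed

context
  fixes Y :: "'a list"
  assumes Yd: "distinct Y" and Yset: "set Y = e ` {2..2 * n - 1}" and Yl: "length Y = 2 * (n - 1)"
begin

lemma sum_over_list: "(\<Sum>i\<in>{2..2 * n - 1}. f (e i)) = (\<Sum>p<2 * (n - 1). f (Y ! p))"
proof -
  have "inj_on e {2..2 * n - 1}" by (rule orthonormal_inj) (use e_orth in auto)
  then have "(\<Sum>i\<in>{2..2 * n - 1}. f (e i)) = sum f (set Y)"
    by (simp add: Yset sum.reindex)
  also have "\<dots> = (\<Sum>p<2 * (n - 1). f (Y ! p))"
    by (rule sum.reindex_bij_betw[OF bij_betw_nth, symmetric]) (use Yd Yl in auto)
  finally show ?thesis .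
qed

lemma \<eta>_contract:
  assumes x: "x \<in> N \<inter> J ` N" and j: "j < 2 * (n - 1)"
  shows "\<eta> (x # nths Y (- {j})) = (-1) ^ j * g x (Y ! j) * \<eta> Y"
proof (rule alternating_contract[OF \<eta>_swap \<eta>_multilinear Yl j])
  have "x = (\<Sum>i\<in>{2..2 * n - 1}. g x (e i) *\<^sub>R e i)"
    by (rule orthonormal_expansion) (use x N1_span e_orth in auto)
  then show "x = (\<Sum>p<2 * (n - 1). g x (Y ! p) *\<^sub>R Y ! p)"
    using sum_over_list[of "\<lambda>z. g x z *\<^sub>R z"] by simp
qed

lemma Y_N1: "j < 2 * (n - 1) \<Longrightarrow> Y ! j \<in> N \<inter> J ` N"
proof -
  assume "j < 2 * (n - 1)"
  then have "Y ! j \<in> e ` {2..2 * n - 1}" using nth_mem[of j Y] Yset Yl by simp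
  then show ?thesis using e_N1 by auto
qed

text \<open>Of \<open>D (Y ! j)\<close> only the component along \<open>Y ! j\<close> survives, so
  the diagonal entries add up to the trace. The order of \<open>Y\<close> is left open, since
  \<open>balanced_if\<close> meets these vectors in any order.\<close>

lemma derivation_sum_\<eta>: "derivation_sum D \<eta> Y = trA * \<eta> Y"
proof -
  have "derivation_sum D \<eta> Y = (\<Sum>j<2 * (n - 1). g (D (Y ! j)) (Y ! j) * \<eta> Y)"
    unfolding derivation_sum_def Yl
  proof (rule sum.cong[OF refl])
    fix j assume "j \<in> {..<2 * (n - 1)}"
    then have "\<eta> (D (Y ! j) # nths Y (- {j})) = (-1) ^ j * g (D (Y ! j)) (Y ! j) * \<eta> Y"
      by (intro \<eta>_contract D_N1 Y_N1) auto
    then show "(- 1) ^ j * \<eta> (D (Y ! j) # nths Y (- {j})) = g (D (Y ! j)) (Y ! j) * \<eta> Y"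
      by (simp add: power_mult_distrib[symmetric] mult.assoc[symmetric])
  qed
  also have "\<dots> = trA * \<eta> Y"
    unfolding trA_def sum_over_list[of "\<lambda>z. g (D z) z"] sum_distrib_right ..
  finally show ?thesis .
qed

end

text \<open>The order \<open>e 2\<close>, \<open>e (2 * n - 1)\<close>, \<open>e 3\<close>,
  \<open>e (2 * n - 2)\<close> and so on puts each vector right before its image under
  \<open>J\<close>, as \<open>J (e i) = e (2 * n + 1 - i)\<close> for \<open>i \<le> n\<close>. For
  \<open>n = 1\<close> the list is empty.\<close>

definition L :: "'a list" where
  "L = map (\<lambda>i. if even i then e (2 + i div 2) else e (2 * n - 1 - i div 2)) [0..<2 * (n - 1)]"

lemma length_L: "length L = 2 * (n - 1)" by (simp add: L_def)

lemma standard_list_L: "standard_list \<omega> (n - 1) L"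
  unfolding standard_list_def
proof (intro conjI allI impI length_L)
  fix i j assume i: "i < 2 * (n - 1)" and j: "j < 2 * (n - 1)"
  have i': "i div 2 + 2 \<le> n" and j': "j div 2 + 2 \<le> n" using i j by linarith+
  have nth: "L ! i = (if even i then e (2 + i div 2) else e (2 * n - 1 - i div 2))"
    "L ! j = (if even j then e (2 + j div 2) else e (2 * n - 1 - j div 2))"
    using i j by (simp_all add: L_def)
  have J: "J (L ! i) = (if even i then e (2 * n - 1 - i div 2) else - e (2 + i div 2))"
  proof -
    have "2 * n + 1 - (2 + i div 2) = 2 * n - 1 - i div 2"
      "2 * n + 1 - (2 * n - 1 - i div 2) = 2 + i div 2"
      "n < 2 * n - 1 - i div 2" "2 * n - 1 - i div 2 \<le> 2 * n" "1 \<le> 2 + i div 2"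
      using i' by linarith+
    then show ?thesis
      using i' J_e[of "2 + i div 2"] J_e'[of "2 * n - 1 - i div 2"]
      by (metis add.commute nth(1))
  qed
  show "g (J (L ! i)) (L ! j) = (if i div 2 = j div 2
      then (if odd j then 1 else 0) - (if odd i then 1 else 0) else 0)"
  proof -
    have "2 * n - 1 - i div 2 = 2 * n - 1 - j div 2 \<longleftrightarrow> i div 2 = j div 2"
      and "2 * n - 1 - i div 2 \<noteq> 2 + j div 2" "2 + i div 2 \<noteq> 2 * n - 1 - j div 2"
      using i' j' by linarith+
    moreover have "1 \<le> 2 * n - 1 - i div 2" "1 \<le> 2 * n - 1 - j div 2" "2 + i div 2 \<le> 2 * n"
      "2 + j div 2 \<le> 2 * n" using i' j' by linarith+
    ultimately show ?thesis unfolding J unfolding nth by (auto simp: e_orth g_simps)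
  qed
qed

lemma \<eta>_L_pos: "\<eta> L > 0"
  by (rule two_form_power_standard_list_pos[OF standard_list_L])

lemma set_L: "set L = e ` {2..2 * n - 1}"
proof
  show "set L \<subseteq> e ` {2..2 * n - 1}"
  proof
    fix x assume "x \<in> set L"
    then obtain p where p: "p < 2 * (n - 1)"
      "x = (if even p then e (2 + p div 2) else e (2 * n - 1 - p div 2))"
      unfolding L_def by auto
    have "2 + p div 2 \<in> {2..2 * n - 1}" "2 * n - 1 - p div 2 \<in> {2..2 * n - 1}"
      unfolding atLeastAtMost_iff using p(1) by linarith+
    then show "x \<in> e ` {2..2 * n - 1}" unfolding p(2) by (cases "even p") (simp_all only: imageI if_True if_False)
  qed
  show "e ` {2..2 * n - 1} \<subseteq> set L"
  proof
    fix x assume "x \<in> e ` {2..2 * n - 1}"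
    then obtain i where i: "2 \<le> i" "i < 2 * n" "x = e i" by auto
    show "x \<in> set L"
    proof (cases "i \<le> n")
      case True
      moreover have "Suc (Suc (i - 2)) = i" using i by linarith
      ultimately have "2 * (i - 2) < 2 * (n - 1)" "x = L ! (2 * (i - 2))" using i by (auto simp: L_def)
      then show ?thesis using nth_mem length_L by metis
    next
      case False
      have *: "2 * (2 * n - 1 - i) + 1 < 2 * (n - 1)" "2 * n - 1 - (2 * n - 1 - i) = i"
        using i False by linarith+
      then have "x = L ! (2 * (2 * n - 1 - i) + 1)"
        unfolding L_def i(3) by (subst nth_map) simp_all
      with * have "2 * (2 * n - 1 - i) + 1 < 2 * (n - 1)" "x = L ! (2 * (2 * n - 1 - i) + 1)" by auto
      then show ?thesis using nth_mem length_L by metis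
    qed
  qed
qed

lemma card_e_N1: "card (e ` {2..2 * n - 1}) = 2 * (n - 1)"
proof -
  have "inj_on e {2..2 * n - 1}" by (rule orthonormal_inj) (use e_orth in auto)
  from card_image[OF this] show ?thesis by (simp add: diff_mult_distrib2)
qed

lemma distinct_L: "distinct L"
  by (rule card_distinct) (simp add: set_L card_e_N1 length_L)

lemma balanced_imp:
  assumes b: "balanced br J g" shows "v = 0" "trA = 0"
proof -
  have LN: "set L \<subseteq> N" unfolding set_L using e_N by auto
  have "ce_diff br \<eta> (e (2 * n) # L) = 0"
    using b length_L n_pos by (auto simp: balanced_iff)
  then have "trA * \<eta> L = 0"
    using ce_diff_\<eta>_Cons[OF LN length_L] derivation_sum_\<eta>[OF distinct_L set_L length_L] by simp
  then show "trA = 0" using \<eta>_L_pos by simp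
  \<comment> \<open>In the test list \<open>e 1\<close> takes the place of \<open>L ! j\<close>,
    which isolates the component of \<open>v\<close> along \<open>L ! j\<close>.\<close>
  have "g v (L ! j) = 0" if j: "j < 2 * (n - 1)" for j
  proof -
    let ?Z = "nths L (- {j})"
    have lZ: "length ?Z + 1 = 2 * (n - 1)" using j length_L by (simp add: nths_omit)
    have ZN: "set ?Z \<subseteq> N" using set_nths_subset LN by fast
    have eN: "e 1 \<in> N" using e_N n_pos by auto
    have "ce_diff br \<eta> (e (2 * n) # e 1 # ?Z) = 0"
      using b lZ by (auto simp: balanced_iff)
    then have "derivation_sum D \<eta> (e 1 # ?Z) = 0"
      using ce_diff_\<eta>_Cons[of "e 1 # ?Z"] lZ ZN eN by simp
    \<comment> \<open>When \<open>D\<close> acts on a vector other than \<open>e 1\<close>, the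
      radical vector \<open>e 1\<close> stays in the list and the term is zero.\<close>
    moreover have "derivation_sum D (insert_second (e 1) \<eta>) ?Z = 0"
      unfolding derivation_sum_def
    proof (intro sum.neutral ballI)
      fix i assume "i \<in> {..<length ?Z}"
      then have i: "i < length ?Z" by simp
      have "\<eta> (D (?Z ! i) # e 1 # nths ?Z (- {i})) = 0"
      proof (rule \<eta>_radical[of 1])
        show "set (D (?Z ! i) # e 1 # nths ?Z (- {i})) \<subseteq> N"
          using D_N eN ZN set_nths_subset[of ?Z "- {i}"] by auto
        have "length (nths ?Z (- {i})) + 1 = length ?Z"
          using i by (subst nths_omit[OF i]) simp
        then show "length (D (?Z ! i) # e 1 # nths ?Z (- {i})) = 2 * (n - 1)"
          using lZ by simp
      qed simp
      then show "(- 1) ^ i * insert_second (e 1) \<eta> (D (?Z ! i) # nths ?Z (- {i})) = 0"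
        by (simp add: insert_second_def)
    qed
    ultimately have "\<eta> ((a *\<^sub>R e 1 + v) # ?Z) = 0"
      by (simp add: derivation_sum_Cons D_e1)
    moreover have "\<eta> (e 1 # ?Z) = 0"
      by (rule \<eta>_radical[of 1]) (use eN ZN lZ in auto)
    ultimately have "\<eta> (v # ?Z) = 0"
      using linear_add[OF multilinear_head[OF \<eta>_multilinear lZ], of "a *\<^sub>R e 1" v]
        linear_scale[OF multilinear_head[OF \<eta>_multilinear lZ], of a "e 1"] by simp
    then show ?thesis
      using \<eta>_contract[OF distinct_L set_L length_L v_N1 j] \<eta>_L_pos by simp
  qed
  then have "g v (e i) = 0" if "i \<in> {2..2 * n - 1}" for i
    using that set_L length_L by (metis imageI in_set_conv_nth)
  moreover have "v = (\<Sum>i\<in>{2..2 * n - 1}. g v (e i) *\<^sub>R e i)"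
    by (rule orthonormal_expansion) (use v_N1 N1_span e_orth in auto)
  ultimately show "v = 0" by simp
qed

lemma balanced_if:
  assumes v: "v = 0" and tr: "trA = 0" shows "balanced br J g"
  unfolding balanced_iff
proof (intro allI impI)
  fix X :: "'a list" assume lX: "length X = 2 * n - 1"
  show "ce_diff br \<eta> X = 0"
  proof (cases "n = 1")
    \<comment> \<open>Here \<open>\<eta>\<close> is the constant 1 in degree 0, and a list of one
      vector has no pair of indices. The general argument needs \<open>\<eta>\<close> to have a
      first slot.\<close>
    case True
    then obtain x where "X = [x]" using lX by (auto simp: length_Suc_conv)
    then show ?thesis by (simp add: ce_diff_Cons derivation_sum_def)
  next
    case False
    define k where "k = 2 * (n - 1) - 1"
    have k: "2 * (n - 1) = Suc k" "2 * n - 1 = Suc (Suc k)"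
      using False n_pos by (auto simp: k_def)
    have sw: "swap_antisym (Suc (Suc k)) (ce_diff br \<eta>)"
      by (rule swap_antisym_ce_diff[OF br_anti])
         (use \<eta>_swap \<eta>_multilinear in \<open>simp_all only: k\<close>)
    have lin: "linear (\<lambda>x. ce_diff br \<eta> (x # Z))" if "length Z + 1 = Suc (Suc k)" for Z
      by (rule ce_diff_head_linear[OF br_bilinear, of k])
         (use \<eta>_multilinear that in \<open>simp_all only: k Suc_eq_plus1 add_right_cancel\<close>)
    show ?thesis
    proof (rule alternating_eq_0_spanning[OF sw lin span_e])
      fix Z assume lZ: "length Z = Suc (Suc k)" and Z: "set Z \<subseteq> e ` {1..2 * n}"
      have NI: "x \<in> N" if "x \<in> e ` {1..2 * n}" "x \<noteq> e (2 * n)" for x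
      proof -
        obtain i where i: "1 \<le> i" "i \<le> 2 * n" "x = e i" using \<open>x \<in> e ` {1..2 * n}\<close> by auto
        then have "i \<noteq> 2 * n" using that(2) by auto
        then show ?thesis using i e_N by auto
      qed
      have N1I: "x \<in> e ` {2..2 * n - 1}" if x: "x \<in> e ` {1..2 * n}" "x \<noteq> e (2 * n)" "x \<noteq> e 1" for x
      proof -
        obtain i where i: "1 \<le> i" "i \<le> 2 * n" "x = e i" using x(1) by auto
        then have "i \<noteq> 2 * n" "i \<noteq> 1" using x(2,3) by auto
        then show ?thesis using i by auto
      qed
      show "ce_diff br \<eta> Z = 0"
      proof (cases "distinct Z")
        case False
        then show ?thesis using swap_antisym_not_distinct[OF sw lZ] by simp
      next
        case dist: True
        show ?thesis
        proof (cases "e (2 * n) \<in> set Z")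
          case False
          then have "x \<in> N" if "x \<in> set Z" for x using NI[of x] Z that by auto
          then have "set Z \<subseteq> N" by (rule subsetI)
          then show ?thesis by (rule ce_diff_\<eta>_N) (simp only: lZ k)
        next
          case True
          obtain U V where UV: "Z = U @ e (2 * n) # V" using split_list[OF True] by (elim exE)
          let ?Y = "U @ V"
          have YZ: "x \<in> e ` {1..2 * n}" "x \<noteq> e (2 * n)" if "x \<in> set ?Y" for x
            using Z dist that unfolding UV by auto
          then have YN: "set ?Y \<subseteq> N" using NI by (meson subsetI)
          have lY: "length ?Y = 2 * (n - 1)" using lZ unfolding UV k by simp
          have "derivation_sum D \<eta> ?Y = 0"
          proof (cases "e 1 \<in> set ?Y")
            case True
            then show ?thesis by (rule derivation_sum_radical[OF v _ YN lY])
          next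
            case False
            then have sub: "set ?Y \<subseteq> e ` {2..2 * n - 1}" using N1I YZ by (metis subsetI)
            have dY: "distinct ?Y" using dist UV by simp
            \<comment> \<open>These are \<open>2 * (n - 1)\<close> distinct vectors taken from a set
              of that size.\<close>
            have "set ?Y = e ` {2..2 * n - 1}"
              by (rule card_subset_eq[OF _ sub]) (use distinct_card[OF dY] lY card_e_N1 in auto)
            from derivation_sum_\<eta>[OF dY this lY] show ?thesis by (simp add: tr)
          qed
          then have "ce_diff br \<eta> (e (2 * n) # ?Y) = 0" using ce_diff_\<eta>_Cons[OF YN lY] by simp
          then show ?thesis
            using swap_antisym_move_front[OF sw, of U V "e (2 * n)"] lZ unfolding UV
            by simp
        qed
      qed
    qed (simp_all only: lX k)
  qed
qed

lemma balanced_iff_data: "balanced br J g \<longleftrightarrow> v = 0 \<and> trace_on (N \<inter> J ` N) A = 0"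
  using balanced_imp balanced_if by (auto simp: trace_on_A)

lemma balanced_ricci_forms:
  assumes "balanced br J g"
  shows "bismut_ricci_form br J g e x y = - a\<^sup>2 * wedge 1 1 (one_form (dual_basis n e 1))
                                      (one_form (dual_basis n e (2 * n))) [x, y]"
    and "chern_ricci_form br J g e x y = - a\<^sup>2 * wedge 1 1 (one_form (dual_basis n e 1))
                                      (one_form (dual_basis n e (2 * n))) [x, y]"
  using ricci_forms_eq[OF balanced_imp[OF assms]]
  by (simp_all only: g_br_e1 wedge_one_forms) (simp_all add: algebra_simps power2_eq_square)

end

section \<open>Adapted bases\<close>

context hermitian_lie_algebra
begin

abbreviation orthonormal_on :: "nat set \<Rightarrow> (nat \<Rightarrow> 'a) \<Rightarrow> bool" where
  "orthonormal_on I e \<equiv> \<forall>i\<in>I. \<forall>j\<in>I. g (e i) (e j) = (if i = j then 1 else 0)"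

lemma finite_spanning_set: "\<exists>B. finite B \<and> span B = (UNIV :: 'a set)"
  using lie by (auto simp: lie_algebra_on_def)

text \<open>An orthonormal family in \<open>V\<close> with at least \<open>dim V\<close> members is
  a basis of \<open>V\<close>. The inequality also fixes the dimension, which is how the whole space
  turns out to be even-dimensional in \<open>adapted_unitary_basis_exists\<close>.\<close>

lemma orthonormal_span:
  assumes V: "subspace V" and I: "finite I" and o: "orthonormal_on I e" and eV: "e ` I \<subseteq> V"
    and c: "dim V \<le> card I"
  shows "V = span (e ` I)" and "dim V = card I"
proof -
  have ind: "independent (e ` I)" by (rule orthonormal_independent[OF I]) (use o in auto)
  have card: "card (e ` I) = card I"
    by (rule card_image, rule orthonormal_inj) (use o in auto)
  obtain B where B: "e ` I \<subseteq> B" "B \<subseteq> V" "independent B" "V \<subseteq> span B"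
    using maximal_independent_subset_extend[OF eV ind] by blast
  obtain B0 where "finite B0" "span B0 = (UNIV :: 'a set)" using finite_spanning_set by blast
  then have fB: "finite B" using independent_span_bound[of B0 B] B(3) by auto
  have cB: "card B = dim V" by (rule basis_card_eq_dim[OF B(2,4,3)])
  then have "e ` I = B" using card_seteq[OF fB B(1)] card c by simp
  then show "V = span (e ` I)" "dim V = card I"
    using B cB card span_minimal[OF B(2) V] by auto
qed

text \<open>A Gram-Schmidt step: a vector of \<open>V\<close> outside the span of the family, minus
  its projection, is normalised.\<close>

lemma orthonormal_extend:
  assumes V: "subspace V" and I: "finite I" and o: "orthonormal_on I e" and eV: "e ` I \<subseteq> V"
    and c: "card I < dim V"
  shows "\<exists>u\<in>V. g u u = 1 \<and> (\<forall>i\<in>I. g u (e i) = 0)"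
proof -
  have "\<not> V \<subseteq> span (e ` I)"
    using dim_le_card[of V "e ` I"] card_image_le[OF I, of e] I c by auto
  then obtain x where x: "x \<in> V" "x \<notin> span (e ` I)" by blast
  define p where "p = (\<Sum>i\<in>I. g x (e i) *\<^sub>R e i)"
  have p: "p \<in> span (e ` I)" unfolding p_def by (intro span_sum span_scale span_base) auto
  define y where "y = x - p"
  have "y \<noteq> 0" using x(2) p by (auto simp: y_def)
  then have y: "g y y > 0" by (rule g_pos)
  have "p \<in> V" using p span_minimal[OF eV V] by blast
  then have yV: "y \<in> V" unfolding y_def using x(1) V by (simp add: subspace_diff)
  have orth: "g y (e i) = 0" if "i \<in> I" for i
  proof -
    have "g p (e i) = (\<Sum>j\<in>I. g x (e j) * g (e j) (e i))"
      unfolding p_def by (simp add: linear_sum[OF g_linear_left] g_simps)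
    also have "\<dots> = (\<Sum>j\<in>I. if j = i then g x (e j) else 0)"
      by (rule sum.cong) (use o that in auto)
    finally show ?thesis using I that by (simp add: y_def g_simps)
  qed
  define u where "u = (1 / sqrt (g y y)) *\<^sub>R y"
  have "g u u = 1" using y by (simp add: u_def g_simps real_sqrt_mult_self field_simps)
  moreover have "u \<in> V" unfolding u_def using yV V by (simp add: subspace_scale)
  moreover have "\<forall>i\<in>I. g u (e i) = 0" using orth by (simp add: u_def g_simps)
  ultimately show ?thesis by blast
qed

lemma orthonormal_exists:
  assumes V: "subspace V"
  shows "k \<le> dim V \<Longrightarrow> \<exists>e. orthonormal_on {..<k} e \<and> e ` {..<k} \<subseteq> V"
proof (induction k)
  case (Suc k)
  then obtain e where e: "orthonormal_on {..<k} e" "e ` {..<k} \<subseteq> V" by auto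
  obtain u where u: "u \<in> V" "g u u = 1" "\<forall>i\<in>{..<k}. g u (e i) = 0"
    using orthonormal_extend[OF V _ e] Suc.prems by auto
  have "g (e i) u = 0" if "i < k" for i using u(3) that g_sym by simp
  then have "orthonormal_on {..<Suc k} (e(k := u)) \<and> (e(k := u)) ` {..<Suc k} \<subseteq> V"
    using e u by (auto simp: less_Suc_eq)
  then show ?case by blast
qed simp

lemma unit_normal_exists:
  assumes V: "subspace V" and c: "dim (UNIV :: 'a set) = dim V + 1"
  shows "\<exists>u. g u u = 1 \<and> (\<forall>x. x \<in> V \<longleftrightarrow> g x u = 0)"
proof -
  define d where "d = dim V"
  let ?I = "{..<d}"
  obtain w where w: "orthonormal_on ?I w" "w ` ?I \<subseteq> V" using orthonormal_exists[OF V order_refl] unfolding d_def by blast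
  have Vw: "V = span (w ` ?I)" by (rule orthonormal_span[OF V _ w]) (simp_all add: d_def)
  obtain u where u: "g u u = 1" "\<forall>i\<in>?I. g u (w i) = 0"
    using orthonormal_extend[OF subspace_UNIV _ w(1)] c by (auto simp: d_def)
  have wu: "g (w i) u = 0" if "i < d" for i using u(2) that g_sym by simp
  have "x \<in> V \<longleftrightarrow> g x u = 0" for x
  proof
    assume "x \<in> V"
    then show "g x u = 0"
      unfolding Vw by (rule linear_eq_0_on_span[OF g_linear_left, rotated]) (use wu in auto)
  next
    assume x: "g x u = 0"
    let ?h = "w(d := u)" and ?K = "{..<Suc d}"
    have o: "orthonormal_on ?K ?h" using w(1) u wu by (auto simp: less_Suc_eq)
    have "UNIV = span (?h ` ?K)" by (rule orthonormal_span[OF subspace_UNIV _ o]) (use c in \<open>auto simp: d_def\<close>)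
    then have "x = (\<Sum>i\<in>?K. g x (?h i) *\<^sub>R ?h i)"
      by (intro orthonormal_expansion) (use o in auto)
    also have "\<dots> = (\<Sum>i\<in>?I. g x (w i) *\<^sub>R w i)" using x by simp
    also have "\<dots> \<in> V" unfolding Vw by (intro span_sum span_scale span_base) auto
    finally show "x \<in> V" .
  qed
  then show ?thesis using u(1) by blast
qed

text \<open>Orthonormality over the complex numbers: as \<open>g\<close> is invariant under
  \<open>J\<close>, the vectors \<open>f i\<close> and \<open>J (f i)\<close> together are
  orthonormal.\<close>

definition unitary_family :: "nat \<Rightarrow> (nat \<Rightarrow> 'a) \<Rightarrow> bool" where
  "unitary_family k f \<longleftrightarrow> (\<forall>i<k. \<forall>j<k. g (f i) (f j) = (if i = j then 1 else 0) \<and> g (J (f i)) (f j) = 0)"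

text \<open>Runs through \<open>f\<close> and then backwards through its image under
  \<open>J\<close>, so that positions \<open>i\<close> and \<open>2 * k - 1 - i\<close> are
  partners. With indices shifted by one this is the rule
  \<open>J (e i) = e (2 * n + 1 - i)\<close>.\<close>

definition real_family :: "nat \<Rightarrow> (nat \<Rightarrow> 'a) \<Rightarrow> nat \<Rightarrow> 'a" where
  "real_family k f i = (if i < k then f i else J (f (2 * k - 1 - i)))"

lemma orthonormal_real_family:
  assumes f: "unitary_family k f" shows "orthonormal_on {..<2 * k} (real_family k f)"
proof (intro ballI)
  fix i j assume i: "i \<in> {..<2 * k}" and j: "j \<in> {..<2 * k}"
  have ff: "g (f i) (f j) = (if i = j then 1 else 0)" and Jff: "g (J (f i)) (f j) = 0"
    if "i < k" "j < k" for i j using f that by (auto simp: unitary_family_def)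
  have fJf: "g (f i) (J (f j)) = 0" if "i < k" "j < k" for i j using Jff[OF that] g_J_left by simp
  have *: "2 * k - 1 - i < k" if "\<not> i < k" "i \<in> {..<2 * k}" for i
    using that unfolding lessThan_iff by linarith
  have **: "2 * k - 1 - i = 2 * k - 1 - j \<longleftrightarrow> i = j" using i j by auto
  show "g (real_family k f i) (real_family k f j) = (if i = j then 1 else 0)"
  proof (cases "i < k")
    case ik: True
    show ?thesis
    proof (cases "j < k")
      case True
      then show ?thesis using ff ik by (simp add: real_family_def)
    next
      case False
      then have "i \<noteq> j" using ik by auto
      then show ?thesis using fJf[OF ik *[OF False j]] ik False by (simp add: real_family_def)
    qed
  next
    case ik: False
    show ?thesis
    proof (cases "j < k")
      case True
      then have "i \<noteq> j" using ik by auto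
      then show ?thesis using Jff[OF *[OF ik i] True] ik True by (simp add: real_family_def)
    next
      case False
      show ?thesis
        using ff[OF *[OF ik i] *[OF False j]] ** ik False
        by (simp only: real_family_def if_False g_J_J)
    qed
  qed
qed

text \<open>Complex Gram-Schmidt. If \<open>w\<close> is orthogonal to all \<open>f i\<close> and
  \<open>J (f i)\<close>, then so is \<open>J w\<close>, by skewness of \<open>J\<close>, which also
  gives \<open>g (J w) w = 0\<close>. The first vector is prescribed, so that the ideal can dictate
  it.\<close>

lemma unitary_family_exists:
  assumes u: "g u u = 1"
  shows "2 * k < dim (UNIV :: 'a set) \<Longrightarrow> \<exists>f. unitary_family (Suc k) f \<and> f 0 = u"
proof (induction k)
  case 0
  have "g (J u) u = 0" using g_J_left[of u u] g_sym[of u] by simp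
  then show ?case using u by (intro exI[of _ "\<lambda>_. u"]) (simp add: unitary_family_def)
next
  case (Suc k)
  then obtain f where f: "unitary_family (Suc k) f" "f 0 = u" by auto
  let ?k = "Suc k"
  obtain w where w: "g w w = 1" "\<forall>i\<in>{..<2 * ?k}. g w (real_family ?k f i) = 0"
    using orthonormal_extend[OF subspace_UNIV _ orthonormal_real_family[OF f(1)]] Suc.prems by auto
  have wf: "g w (f i) = 0" if "i < ?k" for i
    using w(2)[rule_format, of i] that by (simp add: real_family_def)
  have wJf: "g w (J (f i)) = 0" if "i < ?k" for i
  proof -
    have "\<not> 2 * ?k - 1 - i < ?k" "2 * ?k - 1 - (2 * ?k - 1 - i) = i" "2 * ?k - 1 - i \<in> {..<2 * ?k}"
      using that unfolding lessThan_iff by presburger+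
    then show ?thesis
      using w(2)[rule_format, of "2 * ?k - 1 - i"] unfolding real_family_def by (simp only: if_False)
  qed
  have Jw: "g (J w) w = 0" using g_J_left[of w w] g_sym[of w] by simp
  have "unitary_family (Suc ?k) (f(?k := w))"
    unfolding unitary_family_def
  proof (intro allI impI)
    fix i j assume "i < Suc ?k" "j < Suc ?k"
    then consider "i < ?k" "j < ?k" | "i = ?k" "j < ?k" | "i < ?k" "j = ?k" | "i = ?k" "j = ?k"
      by linarith
    then show "g ((f(?k := w)) i) ((f(?k := w)) j) = (if i = j then 1 else 0)
        \<and> g (J ((f(?k := w)) i)) ((f(?k := w)) j) = 0"
    proof cases
      case 1
      then show ?thesis using f(1) by (simp add: unitary_family_def)
    next
      case 2
      then show ?thesis using wf[of j] wJf[of j] by (simp add: g_J_left)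
    next
      case 3
      then show ?thesis using wf[of i] wJf[of i] g_sym[of _ w] by simp
    next
      case 4
      then show ?thesis using w Jw by simp
    qed
  qed
  moreover have "(f(?k := w)) 0 = u" using f(2) by simp
  ultimately show ?case by blast
qed

lemma adapted_unitary_basis_exists:
  assumes N: "codim_one_abelian_ideal br N"
  shows "\<exists>n e. dim (UNIV :: 'a set) = 2 * n \<and> adapted_unitary_basis J g N n e"
proof -
  have sN: "subspace N" and dN: "dim (UNIV :: 'a set) = dim N + 1"
    using N by (auto simp: codim_one_abelian_ideal_def abelian_ideal_def)
  obtain u where u: "g u u = 1" and Nu: "\<And>x. x \<in> N \<longleftrightarrow> g x u = 0"
    using unit_normal_exists[OF sN dN] by blast
  \<comment> \<open>The parity of the dimension is not known yet. This \<open>n\<close> satisfies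
    \<open>dim UNIV \<le> 2 * n\<close>, and the construction supplies \<open>2 * n\<close>
    orthonormal vectors, so equality follows.\<close>
  define n where "n = Suc (dim N div 2)"
  have uJ: "g (- J u) (- J u) = 1" using u by (simp add: g_simps)
  have "2 * (dim N div 2) < dim (UNIV :: 'a set)" using dN by linarith
  \<comment> \<open>Starting from \<open>- J u\<close> gives \<open>e 1 = - J u\<close> and
    \<open>e (2 * n) = J (e 1) = u\<close>, the unit normal of \<open>N\<close>.\<close>
  then obtain f where f: "unitary_family n f" "f 0 = - J u"
    using unitary_family_exists[OF uJ, of "dim N div 2"] by (auto simp: n_def)
  have "dim (UNIV :: 'a set) \<le> card {..<2 * n}" using dN by (simp add: n_def)
  from orthonormal_span(2)[OF subspace_UNIV _ orthonormal_real_family[OF f(1)] _ this]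
  have d: "dim (UNIV :: 'a set) = 2 * n" by simp
  have n: "n \<ge> 1" by (simp add: n_def)
  define e where "e i = real_family n f (i - 1)" for i
  have o: "orthonormal_on {1..2 * n} e"
    using orthonormal_real_family[OF f(1)] by (auto simp: e_def)
  have span: "UNIV = span (e ` {1..2 * n})"
    by (rule orthonormal_span[OF subspace_UNIV _ o]) (use d in auto)
  have Je: "J (e i) = e (2 * n + 1 - i)" if "i \<in> {1..n}" for i
  proof -
    have "i - 1 < n" "\<not> 2 * n + 1 - i - 1 < n" "2 * n - 1 - (2 * n + 1 - i - 1) = i - 1"
      using that by auto
    then show ?thesis by (simp add: e_def real_family_def)
  qed
  have e1: "e 1 = - J u" using f(2) n by (simp add: e_def real_family_def)
  have e2n: "e (2 * n) = u" using Je[of 1] n e1 by (simp add: J_simps)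
  have eN: "e i \<in> N" if "i \<in> {1..2 * n - 1}" for i
    unfolding Nu e2n[symmetric] using o that n by auto
  have Ne: "N = span (e ` {1..2 * n - 1})"
    by (rule orthonormal_span[OF sN]) (use o eN dN d n in auto)
  have JN: "x \<in> J ` N \<longleftrightarrow> J x \<in> N" for x
  proof
    assume "J x \<in> N"
    then have "- J x \<in> N" using subspace_neg[OF sN] by blast
    then show "x \<in> J ` N" by (rule image_eqI[rotated]) (simp add: J_simps)
  qed (use subspace_neg[OF sN] in auto)
  have N1: "x \<in> N \<inter> J ` N \<longleftrightarrow> g x (e 1) = 0 \<and> g x (e (2 * n)) = 0" for x
    unfolding Int_iff JN Nu e1 e2n by (auto simp: g_J_left g_simps)
  have N1e: "N \<inter> J ` N = span (e ` {2..2 * n - 1})"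
  proof
    show "N \<inter> J ` N \<subseteq> span (e ` {2..2 * n - 1})"
    proof
      fix x assume "x \<in> N \<inter> J ` N"
      then have x: "g x (e 1) = 0" "g x (e (2 * n)) = 0" using N1 by auto
      have "x = (\<Sum>i\<in>{1..2 * n}. g x (e i) *\<^sub>R e i)"
        by (rule orthonormal_expansion) (use o span in auto)
      also have "\<dots> = (\<Sum>i\<in>{2..2 * n - 1}. g x (e i) *\<^sub>R e i)"
      proof (rule sum.mono_neutral_right)
        show "\<forall>i\<in>{1..2 * n} - {2..2 * n - 1}. g x (e i) *\<^sub>R e i = 0"
        proof
          fix i assume "i \<in> {1..2 * n} - {2..2 * n - 1}"
          then have "i = 1 \<or> i = 2 * n" by auto
          then show "g x (e i) *\<^sub>R e i = 0" using x by auto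
        qed
      qed auto
      also have "\<dots> \<in> span (e ` {2..2 * n - 1})"
        by (intro span_sum span_scale span_base) auto
      finally show "x \<in> span (e ` {2..2 * n - 1})" .
    qed
    have "subspace (N \<inter> J ` N)"
      by (intro subspace_inter sN linear_subspace_image[OF J_linear])
    moreover have "e ` {2..2 * n - 1} \<subseteq> N \<inter> J ` N"
    proof
      fix x assume "x \<in> e ` {2..2 * n - 1}"
      then obtain i where "i \<in> {2..2 * n - 1}" "x = e i" by auto
      then show "x \<in> N \<inter> J ` N" unfolding N1 using o n by auto
    qed
    ultimately show "span (e ` {2..2 * n - 1}) \<subseteq> N \<inter> J ` N" by (intro span_minimal)
  qed
  have "orthonormal_basis g e"
    unfolding orthonormal_basis_def d using span o by simp
  then show ?thesis
    using d Ne N1e Je unfolding adapted_unitary_basis_def by blast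
qed

end

text \<open>Splitting \<open>br (e (2 * n)) (e 1)\<close> along \<open>e 1\<close> yields
  \<open>a\<close> and \<open>v\<close>. Since \<open>A\<close> matters only on
  \<open>N\<^sub>1\<close>, the adjoint map itself serves as \<open>A\<close>.\<close>

lemma hermitian_almost_abelian_exists:
  assumes L: "lie_algebra br" and H: "hermitian_structure br J g" and N: "codim_one_abelian_ideal br N"
  shows "\<exists>n e a v. hermitian_almost_abelian br J g n e N a v (br (e (2 * n)))"
proof -
  interpret hermitian_lie_algebra br J g by (rule hermitian_lie_algebra.intro[OF L H])
  obtain n e where d: "dim (UNIV :: 'a set) = 2 * n" and E: "adapted_unitary_basis J g N n e"
    using adapted_unitary_basis_exists[OF N] by blast
  let ?D = "br (e (2 * n))"
  define a where "a = g (?D (e 1)) (e 1)"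
  define v where "v = ?D (e 1) - a *\<^sub>R e 1"
  have sN: "subspace N" and idN: "\<And>x y. y \<in> N \<Longrightarrow> br x y \<in> N" and n: "n \<ge> 1"
    using N d by (auto simp: codim_one_abelian_ideal_def abelian_ideal_def)
  have o: "orthonormal_on {1..2 * n} e" and Ne: "N = span (e ` {1..2 * n - 1})"
    and N1e: "N \<inter> J ` N = span (e ` {2..2 * n - 1})"
    using E d by (auto simp: adapted_unitary_basis_def orthonormal_basis_def)
  have e1: "e 1 \<in> N" unfolding Ne using n by (auto intro: span_base)
  have vN: "v \<in> N"
    unfolding v_def by (intro subspace_diff[OF sN] subspace_scale[OF sN] idN e1)
  have ve1: "g v (e 1) = 0" using o n by (simp add: v_def a_def g_simps)
  have "v = (\<Sum>i\<in>{1..2 * n - 1}. g v (e i) *\<^sub>R e i)"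
    by (rule orthonormal_expansion) (use o vN Ne in auto)
  also have "\<dots> = (\<Sum>i\<in>{2..2 * n - 1}. g v (e i) *\<^sub>R e i)"
  proof (rule sum.mono_neutral_right)
    show "\<forall>i\<in>{1..2 * n - 1} - {2..2 * n - 1}. g v (e i) *\<^sub>R e i = 0"
    proof
      fix i assume "i \<in> {1..2 * n - 1} - {2..2 * n - 1}"
      then have "i = 1" by auto
      then show "g v (e i) *\<^sub>R e i = 0" using ve1 by simp
    qed
  qed auto
  also have "\<dots> \<in> N \<inter> J ` N"
    unfolding N1e by (intro span_sum span_scale span_base) auto
  finally have "v \<in> N \<inter> J ` N" .
  then have "algebraic_data br J N n e a v ?D"
    by (simp add: algebraic_data_def v_def)
  then have "hermitian_almost_abelian br J g n e N a v ?D"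
    using d E N by unfold_locales (auto simp: adapted_unitary_basis_def)
  then show ?thesis by blast
qed

section \<open>Unimodularity and splitting off a central line\<close>

context hermitian_almost_abelian
begin

lemma unimodular_imp: "unimodular br \<Longrightarrow> a + trA = 0"
proof -
  assume "unimodular br"
  then have "trace_on UNIV D = 0" by (simp add: unimodular_def)
  moreover have "trace_on UNIV D = (\<Sum>i\<in>{1..2 * n}. g (D (e i)) (e i))"
  proof (rule trace_on_orthonormal)
    show "UNIV = span (e ` {1..2 * n})" using span_e by simp
    show "linear D" using br_bilinear by (simp add: bilinear_def)
  qed (use e_orth in auto)
  ultimately show ?thesis using tr_ad_eq[of "e (2 * n)"] n_pos by (simp add: e_orth)
qed

text \<open>For \<open>a = 0\<close> and \<open>v = 0\<close> the vector \<open>e\<^sub>1\<close> is central and splits off.\<close>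

lemma decomposable_of_central:
  assumes a: "a = 0" and v: "v = 0" shows "decomposable br"
proof -
  let ?p = "\<lambda>x. x - g x (e 1) *\<^sub>R e 1"
  \<comment> \<open>For \<open>a = 0\<close> every bracket is orthogonal to \<open>e 1\<close> by
    \<open>g_br_e1\<close>, so \<open>?V2\<close> is closed under \<open>br\<close>; it is nonzero
    because it contains \<open>e (2 * n)\<close>.\<close>
  let ?V1 = "span {e 1}" and ?V2 = "{x. g x (e 1) = 0}"
  let ?f = "\<lambda>x. (g x (e 1) *\<^sub>R e 1, ?p x)"
  have e11: "g (e 1) (e 1) = 1" using n_pos e_orth by simp
  have p: "g (?p x) (e 1) = 0" for x by (simp add: g_simps e11)
  have lin: "linear ?p" by (rule linearI) (simp_all add: g_simps algebra_simps)
  have "?V2 = range ?p"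
  proof
    show "?V2 \<subseteq> range ?p"
    proof
      fix x assume "x \<in> ?V2"
      then have "x = ?p x" by simp
      then show "x \<in> range ?p" by blast
    qed
  qed (use p in auto)
  also have "\<dots> = span (?p ` e ` {1..2 * n})"
    unfolding linear_span_image[OF lin] span_e ..
  finally have V2: "?V2 = span (?p ` e ` {1..2 * n})" .
  have central: "br x (e 1) = 0" "br (e 1) x = 0" for x
  proof -
    show "br x (e 1) = 0" using n_pos by (subst br_eq) (simp add: D_e1 a v e_orth)
    then show "br (e 1) x = 0" by (subst br_anti) simp
  qed
  have "lie_algebra_on ?V1 (\<lambda>_ _. 0)"
    unfolding lie_algebra_on_def by (auto intro: span_zero)
  moreover have "lie_algebra_on ?V2 br"
  proof -
    have "\<exists>B. finite B \<and> span B = ?V2"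
      unfolding V2 by (rule exI[of _ "?p ` e ` {1..2 * n}"]) simp
    then show ?thesis
      using lie unfolding lie_algebra_on_def by (auto simp: g_br_e1 a)
  qed
  moreover have "?V1 \<noteq> {0}"
  proof -
    have "e 1 \<noteq> 0" using e11 by (auto simp: g_simps)
    moreover have "e 1 \<in> ?V1" by (rule span_base) simp
    ultimately show ?thesis by blast
  qed
  moreover have "?V2 \<noteq> {0}"
  proof -
    have "g (e (2 * n)) (e (2 * n)) = 1" and "g (e (2 * n)) (e 1) = 0"
      using n_pos by (simp_all add: e_orth)
    moreover from this(1) have "e (2 * n) \<noteq> 0" by (auto simp: g_simps)
    ultimately show ?thesis by blast
  qed
  moreover have "linear ?f"
    by (rule linearI) (simp_all add: g_simps algebra_simps)
  moreover have "bij_betw ?f UNIV (?V1 \<times> ?V2)"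
  proof (rule bij_betwI[where g = "\<lambda>(x, y). x + y"])
    show "?f \<in> UNIV \<rightarrow> ?V1 \<times> ?V2" using p by (auto intro: span_scale span_base)
    fix z assume "z \<in> ?V1 \<times> ?V2"
    then obtain c y where "z = (c *\<^sub>R e 1, y)" "g y (e 1) = 0" by (auto simp: span_singleton)
    then show "?f (case z of (x, y) \<Rightarrow> x + y) = z" by (simp add: g_simps e11)
  qed auto
  moreover have "?f (br x y) = (0, br (snd (?f x)) (snd (?f y)))" for x y
    by (simp add: g_br_e1 a br_simps central)
  then have "\<forall>x y. ?f (br x y) = ((\<lambda>_ _. 0) (fst (?f x)) (fst (?f y)), br (snd (?f x)) (snd (?f y)))"
    by blast
  ultimately show ?thesis unfolding decomposable_def
    by (intro exI[of _ ?V1] exI[of _ ?V2] exI[of _ "\<lambda>_ _. 0"] exI[of _ br] exI[of _ ?f]) (intro conjI)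
qed

end

section \<open>Balanced Hermitian structures\<close>

theorem theorem3p1:
  fixes br :: "'a::real_vector \<Rightarrow> 'a \<Rightarrow> 'a"
  assumes "lie_algebra br"
  shows "(\<forall>J g N n e a v A.
            hermitian_structure br J g \<and> codim_one_abelian_ideal br N \<and>
            dim (UNIV :: 'a set) = 2 * n \<and>
            adapted_unitary_basis J g N n e \<and> algebraic_data br J N n e a v A \<longrightarrow>
            (balanced br J g \<longleftrightarrow> v = 0 \<and> trace_on (N \<inter> J ` N) A = 0) \<and>
            (balanced br J g \<longrightarrow>
               (\<forall>X Y.
                  bismut_ricci_form br J g e X Y
                    = - a\<^sup>2 * wedge 1 1 (one_form (dual_basis n e 1))
                                      (one_form (dual_basis n e (2 * n))) [X, Y] \<and>
                  chern_ricci_form br J g e X Y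
                    = - a\<^sup>2 * wedge 1 1 (one_form (dual_basis n e 1))
                                      (one_form (dual_basis n e (2 * n))) [X, Y])))
       \<and> (almost_abelian br \<and> unimodular br \<and>
          (\<exists>J g. hermitian_structure br J g \<and> balanced br J g) \<longrightarrow>
            decomposable br \<and>
            (\<forall>J g e. hermitian_structure br J g \<and> balanced br J g \<and> orthonormal_basis g e \<longrightarrow>
               (\<forall>X Y. bismut_ricci_form br J g e X Y = 0)))"
proof (rule conjI, intro allI impI, elim conjE)
  fix J g N n e a v A
  assume H: "hermitian_structure br J g" "codim_one_abelian_ideal br N"
    "dim (UNIV :: 'a set) = 2 * n" "adapted_unitary_basis J g N n e" "algebraic_data br J N n e a v A"
  interpret hermitian_almost_abelian br J g n e N a v A
    using assms H by unfold_locales (auto simp: adapted_unitary_basis_def)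
  show "(balanced br J g \<longleftrightarrow> v = 0 \<and> trace_on (N \<inter> J ` N) A = 0) \<and>
            (balanced br J g \<longrightarrow>
               (\<forall>X Y.
                  bismut_ricci_form br J g e X Y
                    = - a\<^sup>2 * wedge 1 1 (one_form (dual_basis n e 1))
                                      (one_form (dual_basis n e (2 * n))) [X, Y] \<and>
                  chern_ricci_form br J g e X Y
                    = - a\<^sup>2 * wedge 1 1 (one_form (dual_basis n e 1))
                                      (one_form (dual_basis n e (2 * n))) [X, Y]))"
    using balanced_iff_data balanced_ricci_forms by blast
next
  show "almost_abelian br \<and> unimodular br \<and>
          (\<exists>J g. hermitian_structure br J g \<and> balanced br J g) \<longrightarrow>
            decomposable br \<and>
            (\<forall>J g e. hermitian_structure br J g \<and> balanced br J g \<and> orthonormal_basis g e \<longrightarrow>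
               (\<forall>X Y. bismut_ricci_form br J g e X Y = 0))"
  proof (intro impI, elim conjE exE)
    fix J0 g0
    assume aa: "almost_abelian br" and uni: "unimodular br"
      and H0: "hermitian_structure br J0 g0" "balanced br J0 g0"
    obtain N where N: "codim_one_abelian_ideal br N" using aa by (auto simp: almost_abelian_def)
    \<comment> \<open>One ideal \<open>N\<close> serves every Hermitian structure on the algebra.
      Decomposability uses the given structure, while the Ricci statement needs all balanced
      ones.\<close>
    have "\<exists>n e v A. hermitian_almost_abelian br J g n e N 0 v A \<and> v = 0"
      if H: "hermitian_structure br J g" "balanced br J g" for J g
    proof -
      obtain n e a v where E: "hermitian_almost_abelian br J g n e N a v (br (e (2 * n)))"
        using hermitian_almost_abelian_exists[OF assms H(1) N] by blast
      interpret hermitian_almost_abelian br J g n e N a v "br (e (2 * n))" by (rule E)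
      have "v = 0" "a = 0" using balanced_imp[OF H(2)] unimodular_imp[OF uni] by auto
      then show ?thesis using E by blast
    qed
    note ex = this
    have "decomposable br"
      using ex[OF H0] hermitian_almost_abelian.decomposable_of_central by blast
    moreover have "bismut_ricci_form br J g e X Y = 0"
      if H: "hermitian_structure br J g" "balanced br J g" "orthonormal_basis g e" for J g e X Y
    proof -
      obtain n e' v A where "hermitian_almost_abelian br J g n e' N 0 v A"
        using ex[OF H(1,2)] by blast
      then interpret hermitian_almost_abelian br J g n e' N 0 v A .
      \<comment> \<open>The Ricci form in the arbitrary basis \<open>e\<close> is traded for the one
        in the adapted basis \<open>e'\<close>, where the coefficient \<open>a\<close> is
        zero.\<close>
      show ?thesis
        unfolding ricci_form_basis_independent[OF H(3)] using balanced_ricci_forms(1)[OF H(2)] by simp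
    qed
    ultimately show "decomposable br \<and>
            (\<forall>J g e. hermitian_structure br J g \<and> balanced br J g \<and> orthonormal_basis g e \<longrightarrow>
               (\<forall>X Y. bismut_ricci_form br J g e X Y = 0))" by blast
  qed
qed

end
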